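(* Let $\mu$ be a probability measure on $[a,b]$ with $\mu\ll\mathscr{L}$, $\frac{d\mu}{d\mathscr{L}}\in W^{1,1}$ and $0<\operatorname{ess\,inf}\frac{d\mu}{d\mathscr{L}}\le\operatorname{ess\,sup}\frac{d\mu}{d\mathscr{L}}<\infty$, let $u_0\in W^{2,1}$ and $t\ge0$. Let $\alpha_k>0$, $\alpha_k\to0$, and for each $k$ let $\Phi_{t,\alpha_k}\in\mathscr{H}$ be a minimizer over $\mathscr{H}$ of $F_{\alpha_k}^{f^{tu_0}_{\alpha_k},\mu}$. Then $\Phi_{t,\alpha_k}$ converges pointwise on $[a,b]$, as $k\to\infty$, to the unique minimizer over $\mathscr{H}$ of $F_0^{tu_0,\mu}(\Phi)=\int_a^b\frac{(\Phi(x)-x)^2}{2}\,d\mu(x)-t\int_a^b\Phi u_0\,d\mu$.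
   Context: Fix reals $a<b$; function spaces are on $[a,b]$ and $\mathscr{L}$ is Lebesgue measure. The Helly space is $\mathscr{H}=\{\Phi:[a,b]\to[a,b]\ :\ \Phi \text{ monotone (non-decreasing)},\ \Phi(a)=a,\ \Phi(b)=b\}$. $\mathsf{Ent}(\nu)=\int \frac{d\nu}{d\mathscr{L}}\log\frac{d\nu}{d\mathscr{L}}\,d\mathscr{L}$ if $\nu\ll\mathscr{L}$ and $+\infty$ otherwise. For $\alpha>0$, a linear functional $f$ and $\Phi\in\mathscr{H}$, $F_\alpha^{f,\mu}(\Phi)=\int_a^b\frac{(\Phi(x)-x)^2}{2}\,d\mu(x)+\alpha\,\mathsf{Ent}(\Phi_\#\mu)-f(\Phi)$. For a velocity $w$, $f_\alpha^{w}(\Phi)=\int_a^b \Phi\, w+\alpha\,\partial_x\Phi\,\partial_x w\,d\mu-\int_a^b\alpha\,\partial_x\Phi\,d\mu$. With $m=\frac{d\mu}{d\mathscr{L}}$, for $\Phi\in\mathscr{H}$ not weakly differentiable this is understood via integration by parts: $f_\alpha^w(\Phi)=\int_a^b\Phi\,[\,w m-\alpha\partial_x(m\,\partial_x w)+\alpha\,\partial_x m\,]\,dx+\alpha[m\,(\partial_x w)\Phi]_a^b-\alpha[m\Phi]_a^b$. (The minimizers of $F_0^{tu_0,\mu}$ describe the entropy, i.e. sticky particle, solutions of the pressureless Euler equations; this is not needed for the statement.) *)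

theory Defs
  imports "HOL-Probability.Probability_Measure" "HOL-Probability.Essential_Supremum"
begin

section \<open>Lebesgue measure on an interval, densities, entropy\<close>

abbreviation leb_on :: "real \<Rightarrow> real \<Rightarrow> real measure" where
  "leb_on a b \<equiv> restrict_space lborel {a..b}"

text \<open>Counterpart of \<^const>\<open>esssup\<close>, with the same convention for non-measurable functions.\<close>

definition essinf ::
  "'a measure \<Rightarrow> ('a \<Rightarrow> 'b::{second_countable_topology, dense_linorder, linorder_topology, complete_linorder}) \<Rightarrow> 'b"
  where "essinf M f = (if f \<in> borel_measurable M then Liminf (ae_filter M) f else bot)"

definition dens :: "real \<Rightarrow> real \<Rightarrow> real measure \<Rightarrow> real \<Rightarrow> real" where
  "dens a b \<nu> x = enn2real (RN_deriv (leb_on a b) \<nu> x)"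

text \<open>
  The integral of \<open>p log p\<close> is taken in the extended reals, as the difference of its positive
  and negative parts: the Bochner integral would give \<open>0\<close> where the entropy is \<open>\<infinity>\<close>.
  The negative part is always finite, since \<open>p log p \<ge> -1/e\<close> and the interval is bounded.
\<close>

definition Ent :: "real \<Rightarrow> real \<Rightarrow> real measure \<Rightarrow> ereal" where
  "Ent a b \<nu> =
    (if absolutely_continuous (leb_on a b) \<nu> then
       enn2ereal (\<integral>\<^sup>+ x. ennreal (dens a b \<nu> x * ln (dens a b \<nu> x)) \<partial>leb_on a b)
       - enn2ereal (\<integral>\<^sup>+ x. ennreal (- (dens a b \<nu> x * ln (dens a b \<nu> x))) \<partial>leb_on a b)
     else \<infinity>)"


section \<open>Sobolev functions on an interval\<close>

text \<open>
  Sobolev functions are represented by arbitrary members of their almost-everywhere class.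
  Test functions are \<open>C\<^sup>1\<close> with compact support in the open interval; by mollification they
  give the same weak derivatives as smooth ones.
\<close>

definition test_fun :: "real \<Rightarrow> real \<Rightarrow> (real \<Rightarrow> real) \<Rightarrow> bool" where
  "test_fun a b \<phi> \<longleftrightarrow> \<phi> C1_differentiable_on UNIV \<and> closure {x. \<phi> x \<noteq> 0} \<subseteq> {a<..<b}"

definition has_weak_deriv :: "real \<Rightarrow> real \<Rightarrow> (real \<Rightarrow> real) \<Rightarrow> (real \<Rightarrow> real) \<Rightarrow> bool" where
  "has_weak_deriv a b u g \<longleftrightarrow>
     integrable (leb_on a b) u \<and> integrable (leb_on a b) g \<and>
     (\<forall>\<phi>. test_fun a b \<phi> \<longrightarrow>
        (\<integral>x. u x * deriv \<phi> x \<partial>leb_on a b) = - (\<integral>x. g x * \<phi> x \<partial>leb_on a b))"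

definition W11 :: "real \<Rightarrow> real \<Rightarrow> (real \<Rightarrow> real) set" where
  "W11 a b = {u. \<exists>g. has_weak_deriv a b u g}"

definition W21 :: "real \<Rightarrow> real \<Rightarrow> (real \<Rightarrow> real) set" where
  "W21 a b = {u. \<exists>g. has_weak_deriv a b u g \<and> g \<in> W11 a b}"

text \<open>The weak derivative, determined up to null sets.\<close>

definition wderiv :: "real \<Rightarrow> real \<Rightarrow> (real \<Rightarrow> real) \<Rightarrow> real \<Rightarrow> real" where
  "wderiv a b u = (SOME g. has_weak_deriv a b u g)"

text \<open>
  The continuous representative on the closed interval of a function in \<open>W\<^sup>1\<^sup>,\<^sup>1\<close>. Its values on
  \<open>[a, b]\<close> are uniquely determined; it supplies the endpoint values in integrations by parts.
\<close>

definition crep :: "real \<Rightarrow> real \<Rightarrow> (real \<Rightarrow> real) \<Rightarrow> real \<Rightarrow> real" where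
  "crep a b v = (SOME g. continuous_on {a..b} g \<and> (AE x in leb_on a b. v x = g x))"


section \<open>Helly space and functionals\<close>

text \<open>
  Members of the Helly space are functions on \<open>[a, b]\<close>, hence extensional as total functions,
  so that equality in HOL is equality on \<open>[a, b]\<close>.
\<close>

definition Helly :: "real \<Rightarrow> real \<Rightarrow> (real \<Rightarrow> real) set" where
  "Helly a b = {\<Phi> \<in> {a..b} \<rightarrow>\<^sub>E {a..b}. mono_on {a..b} \<Phi> \<and> \<Phi> a = a \<and> \<Phi> b = b}"

text \<open>
  The functional \<open>f\<^sub>\<alpha>\<^sup>w\<close>. The first formula is used for functions that are weakly differentiable
  on the closed interval, i.e. that are their own continuous representative up to the
  endpoints. A monotone function with a weak derivative on the open interval may still jump at
  \<open>a\<close> or \<open>b\<close>; the weak derivative ignores such a jump, whereas the boundary terms of the formula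
  obtained by integration by parts involve the actual values at \<open>a\<close> and \<open>b\<close>. With the continuity
  requirement the two formulas agree wherever the first one applies.
\<close>

definition f_ent ::
  "real \<Rightarrow> real \<Rightarrow> real measure \<Rightarrow> real \<Rightarrow> (real \<Rightarrow> real) \<Rightarrow> (real \<Rightarrow> real) \<Rightarrow> real" where
  "f_ent a b \<mu> \<alpha> w \<Phi> =
    (if \<Phi> \<in> W11 a b \<and> continuous_on {a..b} \<Phi> then
       (\<integral>x. \<Phi> x * w x + \<alpha> * wderiv a b \<Phi> x * wderiv a b w x \<partial>\<mu>)
       - (\<integral>x. \<alpha> * wderiv a b \<Phi> x \<partial>\<mu>)
     else
       (let m = dens a b \<mu>; w' = wderiv a b w; m\<^sub>c = crep a b m; w'\<^sub>c = crep a b w' in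
         (\<integral>x. \<Phi> x * (w x * m x - \<alpha> * wderiv a b (\<lambda>y. m y * w' y) x + \<alpha> * wderiv a b m x)
            \<partial>leb_on a b)
         + \<alpha> * (m\<^sub>c b * w'\<^sub>c b * \<Phi> b - m\<^sub>c a * w'\<^sub>c a * \<Phi> a)
         - \<alpha> * (m\<^sub>c b * \<Phi> b - m\<^sub>c a * \<Phi> a)))"

definition F_ent ::
  "real \<Rightarrow> real \<Rightarrow> real measure \<Rightarrow> real \<Rightarrow> ((real \<Rightarrow> real) \<Rightarrow> real) \<Rightarrow> (real \<Rightarrow> real) \<Rightarrow> ereal" where
  "F_ent a b \<mu> \<alpha> f \<Phi> =
     ereal (\<integral>x. (\<Phi> x - x)\<^sup>2 / 2 \<partial>\<mu>) + ereal \<alpha> * Ent a b (distr \<mu> (leb_on a b) \<Phi>) - ereal (f \<Phi>)"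

definition F_zero :: "real measure \<Rightarrow> real \<Rightarrow> (real \<Rightarrow> real) \<Rightarrow> (real \<Rightarrow> real) \<Rightarrow> real" where
  "F_zero \<mu> t u0 \<Phi> = (\<integral>x. (\<Phi> x - x)\<^sup>2 / 2 \<partial>\<mu>) - t * (\<integral>x. \<Phi> x * u0 x \<partial>\<mu>)"

end

theory Submission
  imports Defs
begin

text \<open>
  The entropic functional is a perturbation of size \<open>O(\<alpha>)\<close> of \<open>F\<^sub>0 = F_zero \<mu> t u0\<close>, in the
  following sense. Whichever of its two formulas applies, \<open>f_ent\<close> differs from \<open>t \<integral> \<Phi> u0 d\<mu>\<close> by
  at most \<open>C \<alpha>\<close>, with \<open>C\<close> independent of \<open>\<Phi>\<close>: in the weakly differentiable case because
  \<open>\<Phi>'\<close> is nonnegative with integral at most \<open>b - a\<close> while the density of \<open>\<mu>\<close> and \<open>u0'\<close> are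
  bounded, in the other case because \<open>\<Phi>\<close> is bounded and is multiplied by fixed integrable
  functions (lemma \<open>f_ent_first_order_bound\<close>). The entropy is at least \<open>-(b - a)\<close>, so the
  entropic functional is at least \<open>F\<^sub>0 - C \<alpha>\<close>. It has no such upper bound, since the entropy may
  be infinite; but moving any \<open>\<Phi>\<close> slightly towards the identity bounds its slope away from
  zero, so that the pushforward of \<open>\<mu>\<close> has a bounded density and finite entropy, at an arbitrarily small cost in
  \<open>F\<^sub>0\<close> (lemmas \<open>Ent_pushforward_less_infinity\<close> and
  \<open>finite_entropy_dense_in_energy\<close>). Hence minimizers of the entropic functionals form a
  minimizing sequence of \<open>F\<^sub>0\<close> as \<open>\<alpha> \<rightarrow> 0\<close>.

  Up to a constant, \<open>F\<^sub>0\<close> is half the squared distance in \<open>L\<^sup>2(\<mu>)\<close> to \<open>x + t u0(x)\<close>. By the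
  parallelogram identity minimizing sequences converge in \<open>L\<^sup>2(\<mu>)\<close>, and a limit of monotone maps
  can be chosen in the Helly space, so a minimizer \<open>\<Phi>\<^sub>0\<close> exists (lemma \<open>minimizer_exists\<close>).
  For convergence at every point \<open>\<Phi>\<^sub>0\<close> must not jump inside \<open>(a, b)\<close>. It does not: \<open>u0\<close>
  has a continuous representative, so near a jump the target \<open>x + t u0(x)\<close> stays away from at least
  one of the two one-sided values, and replacing \<open>\<Phi>\<^sub>0\<close> by a constant on a short interval on that
  side decreases \<open>F\<^sub>0\<close> (lemma \<open>minimizer_has_no_jump\<close>). For monotone maps, convergence in
  \<open>L\<^sup>2(\<mu>)\<close> to a map without jumps is convergence at every point
  (lemma \<open>minimizing_sequence_tendsto\<close>). Applied to the constant sequence given by another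
  minimizer, this also yields uniqueness.

  The facts on Sobolev functions of one variable that this uses (representation by an indefinite
  integral, uniqueness of the weak derivative, the product rule, nonnegativity of the derivative of
  a monotone function) all rest on a comparison principle: a finite Borel measure on the line that
  dominates another on open intervals dominates it on all Borel sets. The same principle bounds the
  density of the pushforward under a map of positive slope.
\<close>

section \<open>Comparison of measures on intervals\<close>

lemma bounded_open_connected_real:
  fixes C :: "real set"
  assumes "open C" "connected C" "C \<subseteq> {c<..<d}"
  obtains l u where "C = {l<..<u}"
proof (cases "C = {}")
  case True
  then have "C = {0<..<0}" by simp
  then show ?thesis by (rule that)
next
  case False
  have bdd: "bdd_below C" "bdd_above C"
    using assms(3) by (force simp: bdd_below_def intro: exI[of _ c], force simp: bdd_above_def intro: exI[of _ d])
  have "C = {Inf C<..<Sup C}"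
  proof (intro subset_antisym subsetI)
    fix x assume x: "x \<in> C"
    obtain e where e: "e > 0" "ball x e \<subseteq> C" using \<open>open C\<close> x open_contains_ball by blast
    have "x - e/2 \<in> C" "x + e/2 \<in> C" using e by (auto simp: dist_real_def intro!: subsetD[OF e(2)])
    then have "Inf C \<le> x - e/2" "x + e/2 \<le> Sup C" using bdd by (auto intro: cInf_lower cSup_upper)
    then show "x \<in> {Inf C<..<Sup C}" using e by auto
  next
    fix x assume "x \<in> {Inf C<..<Sup C}"
    then obtain y z where "y \<in> C" "y < x" "z \<in> C" "x < z"
      using False bdd by (auto simp: cInf_less_iff less_cSup_iff)
    then show "x \<in> C" using connected_contains_Icc[OF assms(2), of y z] by auto
  qed
  then show ?thesis by (rule that)
qed

text \<open>
  The sets on which the inequality holds need not form a \<open>\<lambda>\<close>-system, so the argument is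
  topological: an open set is the countable disjoint union of its components, which are intervals,
  and \<open>M\<close> is outer regular.
\<close>

lemma emeasure_le_if_le_on_open_intervals:
  fixes N M :: "real measure"
  assumes N: "sets N = sets borel" and M: "sets M = sets borel"
    and fin: "emeasure M (space M) \<noteq> \<infinity>"
    and le: "\<And>l u. emeasure N {l<..<u} \<le> emeasure M {l<..<u}"
    and A: "A \<in> sets borel"
  shows "emeasure N A \<le> emeasure M A"
proof -
  have conn: "emeasure N C \<le> emeasure M C" if C: "open C" "connected C" for C
  proof -
    define D where "D = (\<lambda>n::nat. C \<inter> {- real n<..<real n})"
    have "emeasure N (D n) \<le> emeasure M (D n)" for n
    proof -
      have "connected (D n)" unfolding D_def
        using C by (auto simp: is_interval_connected_1[symmetric] intro!: is_interval_Int is_interval_oo)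
      moreover have "open (D n)" using C by (auto simp: D_def)
      ultimately obtain l u where "D n = {l<..<u}"
        using bounded_open_connected_real[of "D n" "- real n" "real n"] by (auto simp: D_def)
      then show ?thesis using le by simp
    qed
    then have "(SUP n. emeasure N (D n)) \<le> (SUP n. emeasure M (D n))" by (intro SUP_mono) blast
    moreover have "incseq D" by (auto simp: D_def incseq_def)
    moreover have "(\<Union>n. D n) = C"
    proof -
      have "\<exists>n. x \<in> {- real n<..<real n}" for x :: real
      proof -
      obtain n :: nat where "\<bar>x\<bar> < real n" using reals_Archimedean2 by blast
      then show ?thesis by (intro exI[of _ n]) auto
    qed
      then show ?thesis by (auto simp: D_def)
    qed
    moreover have "range D \<subseteq> sets borel" using C by (auto simp: D_def)
    ultimately show ?thesis using N M by (simp add: SUP_emeasure_incseq)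
  qed
  have "emeasure N U \<le> emeasure M U" if U: "open U" for U
  proof -
    have o: "open C" if "C \<in> components U" for C using open_components U that by blast
    have dj: "pairwise disjnt (components U)"
      using pairwise_disjoint_components[of U] by (auto simp: pairwise_def disjnt_def)
    have cnt: "countable (components U)"
      by (rule countable_disjoint_open_subsets) (auto simp: o dj)
    have dis: "disjoint_family_on (\<lambda>C. C) (components U)"
      using dj by (auto simp: disjoint_family_on_def pairwise_def disjnt_def)
    have eq: "(\<Union>C\<in>components U. C) = U" using Union_components[of U] by simp
    have "emeasure N (\<Union>C\<in>components U. C) = (\<integral>\<^sup>+C. emeasure N C \<partial>count_space (components U))"
      using dis cnt o N by (intro emeasure_UN_countable) auto
    also have "\<dots> \<le> (\<integral>\<^sup>+C. emeasure M C \<partial>count_space (components U))"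
      by (intro nn_integral_mono) (auto simp: o in_components_connected intro!: conn)
    also have "\<dots> = emeasure M (\<Union>C\<in>components U. C)"
      using dis cnt o M by (intro emeasure_UN_countable[symmetric]) auto
    finally show ?thesis by (simp add: eq)
  qed
  moreover have "emeasure N A \<le> emeasure N U" if "A \<subseteq> U" "open U" for U
    using that N by (intro emeasure_mono) auto
  ultimately show ?thesis
    unfolding outer_regular[OF M fin A]
    by (intro INF_greatest) (metis (no_types, lifting) mem_Collect_eq order_trans)
qed

lemma space_leb_on [simp]: "space (leb_on a b) = {a..b}"
  by (simp add: space_restrict_space)

lemma sets_leb_on: "sets (leb_on a b) = sets (restrict_space borel {a..b})"
  by (rule sets_restrict_space_cong) simp

lemma finite_measure_leb_on: "finite_measure (leb_on a b)"
  by (intro finite_measureI) (simp add: emeasure_restrict_space emeasure_lborel_Icc_eq)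

lemma emeasure_leb_on: "A \<subseteq> {a..b} \<Longrightarrow> emeasure (leb_on a b) A = emeasure lborel A"
  by (simp add: emeasure_restrict_space)

lemma borel_measurable_leb_on:
  "f \<in> borel_measurable borel \<Longrightarrow> f \<in> borel_measurable (leb_on a b)"
  by (simp add: measurable_restrict_space1)

lemma AE_leb_on_neq: "AE x in leb_on a b. x \<noteq> c"
  using AE_lborel_singleton[of c] by (auto simp: AE_restrict_space_iff elim: eventually_mono)

text \<open>
  The comparison principle for the measures with densities \<open>h\<^sup>+\<close> and \<open>h\<^sup>-\<close>, evaluated at the set
  where \<open>h\<close> is negative.
\<close>

lemma AE_nonneg_if_interval_integrals_nonneg:
  fixes h :: "real \<Rightarrow> real"
  assumes h: "integrable (leb_on a b) h"
    and nn: "\<And>x y. a \<le> x \<Longrightarrow> x < y \<Longrightarrow> y \<le> b \<Longrightarrow> 0 \<le> (\<integral>s. h s * indicator {x<..<y} s \<partial>leb_on a b)"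
  shows "AE x in leb_on a b. 0 \<le> h x"
proof -
  let ?L = "leb_on a b"
  note [measurable] = borel_measurable_integrable[OF h]
  have id[measurable]: "(\<lambda>x. x) \<in> measurable ?L borel" by (simp add: measurable_restrict_space1)
  define P where "P = distr (density ?L (\<lambda>x. ennreal (h x))) borel (\<lambda>x. x)"
  define N where "N = distr (density ?L (\<lambda>x. ennreal (- h x))) borel (\<lambda>x. x)"
  have eP: "emeasure P A = (\<integral>\<^sup>+x. ennreal (h x * indicator A x) \<partial>?L)"
    and eN: "emeasure N A = (\<integral>\<^sup>+x. ennreal (- (h x * indicator A x)) \<partial>?L)" if [measurable]: "A \<in> sets borel" for A
  proof -
    have A: "(\<lambda>x. x) -` A \<inter> {a..b} \<in> sets ?L" by (subst sets_restrict_space_iff) auto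
    show "emeasure P A = (\<integral>\<^sup>+x. ennreal (h x * indicator A x) \<partial>?L)"
      unfolding P_def using that A
      by (simp add: emeasure_distr emeasure_density id) (auto intro!: nn_integral_cong simp: indicator_def)
    show "emeasure N A = (\<integral>\<^sup>+x. ennreal (- (h x * indicator A x)) \<partial>?L)"
      unfolding N_def using that A
      by (simp add: emeasure_distr emeasure_density id) (auto intro!: nn_integral_cong simp: indicator_def)
  qed
  have iA: "integrable ?L (\<lambda>x. h x * indicator A x)" if [measurable]: "A \<in> sets borel" for A
    by (rule Bochner_Integration.integrable_bound[OF h]) (auto simp: indicator_def)
  have finp: "(\<integral>\<^sup>+x. ennreal (h x * indicator A x) \<partial>?L) < \<infinity>"
    and finn: "(\<integral>\<^sup>+x. ennreal (- (h x * indicator A x)) \<partial>?L) < \<infinity>" if "A \<in> sets borel" for A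
    using real_integrable_def[of ?L "\<lambda>x. h x * indicator A x"] iA[OF that] by (auto simp: less_top)
  have comp: "(emeasure N A \<le> emeasure P A) \<longleftrightarrow> 0 \<le> (\<integral>x. h x * indicator A x \<partial>?L)" if "A \<in> sets borel" for A
  proof -
    have "q \<le> p \<longleftrightarrow> 0 \<le> enn2real p - enn2real q" if "p < \<infinity>" "q < \<infinity>" for p q
      using that by (cases p; cases q) (auto simp: enn2real_ennreal)
    then show ?thesis
      unfolding eP[OF that] eN[OF that] real_lebesgue_integral_def[OF iA[OF that]]
      using finp[OF that] finn[OF that] by blast
  qed
  have ends: "AE x in ?L. x \<noteq> a \<and> x \<noteq> b \<and> x \<in> {a..b}"
    using AE_leb_on_neq[where c=a and a=a and b=b] AE_leb_on_neq[where c=b and a=a and b=b] AE_space[of ?L]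
    by eventually_elim simp
  have le_int: "emeasure N {l<..<u} \<le> emeasure P {l<..<u}" for l u
  proof -
    have "0 \<le> (\<integral>x. h x * indicator {l<..<u} x \<partial>?L)"
    proof (cases "max a l < min b u")
      case True
      have "(\<integral>x. h x * indicator {l<..<u} x \<partial>?L) = (\<integral>x. h x * indicator {max a l<..<min b u} x \<partial>?L)"
      proof (rule integral_cong_AE)
        show "AE x in ?L. h x * indicator {l<..<u} x = h x * indicator {max a l<..<min b u} x"
          using ends by eventually_elim (use True in \<open>auto simp: indicator_def\<close>)
      qed auto
      then show ?thesis using nn[of "max a l" "min b u"] True by simp
    next
      case False
      have "(\<integral>x. h x * indicator {l<..<u} x \<partial>?L) = (\<integral>x. 0 \<partial>?L)"
      proof (rule integral_cong_AE)
        show "AE x in ?L. h x * indicator {l<..<u} x = 0"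
          using ends by eventually_elim (use False in \<open>auto simp: indicator_def\<close>)
      qed auto
      then show ?thesis by simp
    qed
    then show ?thesis by (subst comp) auto
  qed
  have fin: "emeasure P (space P) \<noteq> \<infinity>"
    using finp[of UNIV] eP[of UNIV] by (simp add: P_def space_distr)
  have "sets N = sets borel" "sets P = sets borel" by (simp_all add: N_def P_def)
  note le = emeasure_le_if_le_on_open_intervals[OF this fin le_int]
  define A where "A = {x\<in>{a..b}. h x < 0}"
  have "A \<in> sets ?L" unfolding A_def using borel_measurable_less[OF borel_measurable_integrable[OF h] borel_measurable_const[of 0]] by simp
  then have A[measurable]: "A \<in> sets borel" unfolding sets_leb_on by (subst (asm) sets_restrict_space_iff) auto
  have "0 \<le> (\<integral>x. h x * indicator A x \<partial>?L)" using comp[OF A] le[OF A] by simp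
  moreover have *: "AE x in ?L. - (h x * indicator A x) \<ge> 0" by (auto simp: A_def indicator_def)
  then have "0 \<le> (\<integral>x. - (h x * indicator A x) \<partial>?L)" by (rule integral_nonneg_AE)
  ultimately have "(\<integral>x. - (h x * indicator A x) \<partial>?L) = 0" by simp
  then have "AE x in ?L. - (h x * indicator A x) = 0"
    using integral_nonneg_eq_0_iff_AE[OF _ *] iA[OF A] by simp
  then show ?thesis using AE_space[of ?L] by eventually_elim (auto simp: A_def indicator_def split: if_splits)
qed

lemma AE_zero_if_interval_integrals_zero:
  fixes h :: "real \<Rightarrow> real"
  assumes h: "integrable (leb_on a b) h"
    and "\<And>x y. a \<le> x \<Longrightarrow> x < y \<Longrightarrow> y \<le> b \<Longrightarrow> (\<integral>s. h s * indicator {x<..<y} s \<partial>leb_on a b) = 0"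
  shows "AE x in leb_on a b. h x = 0"
proof -
  have "AE x in leb_on a b. 0 \<le> h x"
    by (rule AE_nonneg_if_interval_integrals_nonneg) (simp_all add: assms)
  moreover have "AE x in leb_on a b. 0 \<le> - h x"
    by (rule AE_nonneg_if_interval_integrals_nonneg) (simp_all add: assms)
  ultimately show ?thesis by eventually_elim auto
qed

lemma id_measurable_leb_on: "(\<lambda>x. x) \<in> borel_measurable (leb_on a b)"
  by (rule borel_measurable_leb_on) simp

section \<open>Indefinite integrals\<close>

lemma integrable_mult_bounded:
  fixes f g :: "real \<Rightarrow> real"
  assumes f: "integrable M f" and g: "g \<in> borel_measurable M" and b: "AE x in M. \<bar>g x\<bar> \<le> B"
  shows "integrable M (\<lambda>x. f x * g x)"
proof (rule Bochner_Integration.integrable_bound)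
  show "integrable M (\<lambda>x. B * f x)" using f by simp
  show "(\<lambda>x. f x * g x) \<in> borel_measurable M" using f g by measurable
  show "AE x in M. norm (f x * g x) \<le> norm (B * f x)"
    using b
  proof eventually_elim
    fix x assume "\<bar>g x\<bar> \<le> B"
    then have "\<bar>f x\<bar> * \<bar>g x\<bar> \<le> \<bar>f x\<bar> * \<bar>B\<bar>" by (intro mult_left_mono) auto
    then show "norm (f x * g x) \<le> norm (B * f x)" by (simp add: abs_mult mult.commute)
  qed
qed

lemma integrable_mult_indicator_borel_leb_on:
  fixes f :: "real \<Rightarrow> real"
  assumes "integrable (leb_on a b) f" "A \<in> sets borel"
  shows "integrable (leb_on a b) (\<lambda>x. f x * indicator A x)"
  using assms by (intro integrable_mult_bounded[where B=1] borel_measurable_leb_on) (auto simp: indicator_def)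

text \<open>
  Since \<open>leb_on a b\<close> lives on \<open>[a, b]\<close>, the half-line stands for \<open>[a, x]\<close>, and the primitive is a
  continuous function on the whole line that is constant on both sides of \<open>[a, b]\<close>.
\<close>

definition prim :: "real \<Rightarrow> real \<Rightarrow> (real \<Rightarrow> real) \<Rightarrow> real \<Rightarrow> real" where
  "prim a b g x = (\<integral>s. g s * indicator {..x} s \<partial>leb_on a b)"

lemma integrable_prim_integrand:
  fixes g :: "real \<Rightarrow> real"
  assumes "integrable (leb_on a b) g"
  shows "integrable (leb_on a b) (\<lambda>s. g s * indicator {..x} s)"
  using assms by (rule integrable_mult_indicator_borel_leb_on) simp

lemma prim_left:
  assumes "integrable (leb_on a b) g"
  shows "prim a b g a = 0"
proof -
  have "(\<integral>s. g s * indicator {..a} s \<partial>leb_on a b) = (\<integral>s. 0 \<partial>leb_on a b)"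
  proof (rule integral_cong_AE)
    show "AE s in leb_on a b. g s * indicator {..a} s = 0"
      using AE_leb_on_neq[where c=a and a=a and b=b] AE_space[of "leb_on a b"]
      by eventually_elim (auto simp: indicator_def)
  qed (use integrable_prim_integrand[OF assms] in auto)
  then show ?thesis by (simp add: prim_def)
qed

lemma prim_right: "prim a b g b = (\<integral>s. g s \<partial>leb_on a b)"
  unfolding prim_def by (intro Bochner_Integration.integral_cong) (auto simp: indicator_def)

lemma prim_diff_eq:
  assumes g: "integrable (leb_on a b) g" and "x \<le> y"
  shows "prim a b g y - prim a b g x = (\<integral>s. g s * indicator {x<..<y} s \<partial>leb_on a b)"
proof -
  have "prim a b g y - prim a b g x
      = (\<integral>s. g s * indicator {..y} s - g s * indicator {..x} s \<partial>leb_on a b)"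
    unfolding prim_def using integrable_prim_integrand[OF g] by simp
  also have "\<dots> = (\<integral>s. g s * indicator {x<..<y} s \<partial>leb_on a b)"
  proof (rule integral_cong_AE)
    show "AE s in leb_on a b. g s * indicator {..y} s - g s * indicator {..x} s = g s * indicator {x<..<y} s"
      using AE_leb_on_neq[where c=y and a=a and b=b]
      by eventually_elim (use \<open>x \<le> y\<close> in \<open>auto simp: indicator_def\<close>)
    show "(\<lambda>s. g s * indicator {x<..<y} s) \<in> borel_measurable (leb_on a b)"
      using integrable_mult_indicator_borel_leb_on[OF g, of "{x<..<y}"] by simp
    show "(\<lambda>s. g s * indicator {..y} s - g s * indicator {..x} s) \<in> borel_measurable (leb_on a b)"
      using integrable_prim_integrand[OF g] by (intro borel_measurable_diff) auto
  qed
  finally show ?thesis .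
qed

lemma prim_add:
  assumes "integrable (leb_on a b) g" "integrable (leb_on a b) h"
  shows "prim a b (\<lambda>s. g s + h s) x = prim a b g x + prim a b h x"
  unfolding prim_def using assms[THEN integrable_prim_integrand] by (simp add: distrib_right)

lemma prim_diff:
  assumes "integrable (leb_on a b) g" "integrable (leb_on a b) h"
  shows "prim a b (\<lambda>s. g s - h s) x = prim a b g x - prim a b h x"
  unfolding prim_def using assms[THEN integrable_prim_integrand] by (simp add: left_diff_distrib)

lemma prim_cmult: "prim a b (\<lambda>s. c * g s) x = c * prim a b g x"
  unfolding prim_def by (simp add: mult.assoc)

lemma abs_prim_le:
  assumes g: "integrable (leb_on a b) g"
  shows "\<bar>prim a b g x\<bar> \<le> (\<integral>s. \<bar>g s\<bar> \<partial>leb_on a b)"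
proof -
  have "\<bar>prim a b g x\<bar> \<le> (\<integral>s. \<bar>g s * indicator {..x} s\<bar> \<partial>leb_on a b)"
    unfolding prim_def by (rule integral_abs_bound)
  also have "\<dots> \<le> (\<integral>s. \<bar>g s\<bar> \<partial>leb_on a b)"
    using g integrable_prim_integrand[OF g] by (intro integral_mono) (auto simp: indicator_def)
  finally show ?thesis .
qed

lemma continuous_prim:
  assumes g: "integrable (leb_on a b) g"
  shows "continuous_on UNIV (prim a b g)"
proof (rule continuous_on_sequentiallyI)
  fix X :: "nat \<Rightarrow> real" and l assume X: "X \<longlonglongrightarrow> l"
  show "(\<lambda>n. prim a b g (X n)) \<longlonglongrightarrow> prim a b g l"
    unfolding prim_def
  proof (rule integral_dominated_convergence)
    show "integrable (leb_on a b) (\<lambda>s. \<bar>g s\<bar>)" using g by simp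
    show "AE s in leb_on a b. (\<lambda>n. g s * indicator {..X n} s) \<longlonglongrightarrow> g s * indicator {..l} s"
      using AE_leb_on_neq[where c=l and a=a and b=b]
    proof eventually_elim
      fix s assume "s \<noteq> l"
      then consider "s < l" | "l < s" by linarith
      then have "\<forall>\<^sub>F n in sequentially. indicator {..X n} s = (indicator {..l} s :: real)"
      proof cases
        case 1
        show ?thesis using order_tendstoD(1)[OF X 1] by eventually_elim (use 1 in auto)
      next
        case 2
        show ?thesis using order_tendstoD(2)[OF X 2] by eventually_elim (use 2 in auto)
      qed
      then show "(\<lambda>n. g s * indicator {..X n} s) \<longlonglongrightarrow> g s * indicator {..l} s"
        by (intro tendsto_mult tendsto_const tendsto_eventually)
    qed
    show "AE s in leb_on a b. norm (g s * indicator {..X n} s) \<le> \<bar>g s\<bar>" for n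
      by (auto simp: indicator_def)
  qed (use integrable_prim_integrand[OF g] in auto)
qed

lemma prim_measurable:
  "integrable (leb_on a b) g \<Longrightarrow> prim a b g \<in> borel_measurable (leb_on a b)"
  by (intro borel_measurable_leb_on borel_measurable_continuous_onI continuous_prim)

text \<open>
  Integration by parts for merely integrable \<open>g\<close> and \<open>h\<close>: the product on the left is the integral of
  \<open>g(s) h(r)\<close> over the square \<open>s, r \<le> x\<close>, which Fubini's theorem evaluates separately on the two
  sides of the diagonal.
\<close>

lemma prim_prim_eq:
  assumes g: "integrable (leb_on a b) g" and h: "integrable (leb_on a b) h"
  shows "prim a b g x * prim a b h x
    = prim a b (\<lambda>s. g s * prim a b h s + prim a b g s * h s) x"
proof -
  let ?L = "leb_on a b"
  interpret L: finite_measure ?L by (rule finite_measure_leb_on)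
  interpret LL: pair_sigma_finite ?L ?L by unfold_locales
  define G where "G = (\<lambda>s. g s * indicator {..x} s)"
  define H where "H = (\<lambda>s. h s * indicator {..x} s)"
  have G: "integrable ?L G" and H: "integrable ?L H"
    unfolding G_def H_def using g h by (auto intro: integrable_prim_integrand)
  note [measurable] = borel_measurable_integrable[OF G] borel_measurable_integrable[OF H]
  have fs[measurable]: "fst \<in> borel_measurable (?L \<Otimes>\<^sub>M ?L)" "snd \<in> borel_measurable (?L \<Otimes>\<^sub>M ?L)"
    using measurable_compose[OF measurable_fst id_measurable_leb_on]
          measurable_compose[OF measurable_snd id_measurable_leb_on] by auto
  define K where "K = (\<lambda>s r. if s < r then G s * H r else 0)"
  have K: "integrable (?L \<Otimes>\<^sub>M ?L) (case_prod K)"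
  proof (rule Bochner_Integration.integrable_bound)
    show "integrable (?L \<Otimes>\<^sub>M ?L) (\<lambda>p. G (fst p) * H (snd p))"
    proof (rule LL.Fubini_integrable)
      show "integrable ?L (\<lambda>x. \<integral>y. norm (G (fst (x, y)) * H (snd (x, y))) \<partial>?L)"
        using G by (simp add: abs_mult)
      show "AE x in ?L. integrable ?L (\<lambda>y. G (fst (x, y)) * H (snd (x, y)))"
        using H by simp
    qed measurable
    show "case_prod K \<in> borel_measurable (?L \<Otimes>\<^sub>M ?L)"
      unfolding K_def split_beta' by measurable
  qed (auto simp: K_def)
  have inner: "(\<integral>r. (if r \<le> s then H r else 0) \<partial>?L) = (if s \<le> x then prim a b h s else prim a b h x)" for s
    unfolding prim_def H_def by (auto intro!: Bochner_Integration.integral_cong simp: indicator_def)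
  have inner': "(\<integral>s. (if s < r then G s else 0) \<partial>?L) = (if r \<le> x then prim a b g r else prim a b g x)" for r
  proof -
    have "(\<integral>s. (if s < r then G s else 0) \<partial>?L) = (\<integral>s. (if s \<le> r then G s else 0) \<partial>?L)"
    proof (rule integral_cong_AE)
      show "AE s in ?L. (if s < r then G s else 0) = (if s \<le> r then G s else 0)"
        using AE_leb_on_neq[where c=r and a=a and b=b] by eventually_elim auto
    qed (use id_measurable_leb_on[of a b] in measurable)
    also have "\<dots> = (if r \<le> x then prim a b g r else prim a b g x)"
      unfolding prim_def G_def by (auto intro!: Bochner_Integration.integral_cong simp: indicator_def)
    finally show ?thesis .
  qed
  have ile: "integrable ?L (\<lambda>r. if r \<le> s then H r else 0)" for s
    using integrable_prim_integrand[OF H, of s]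
    by (rule Bochner_Integration.integrable_cong[THEN iffD1, rotated 2]) (auto simp: indicator_def)
  have ilt: "integrable ?L (\<lambda>r. if s < r then H r else 0)" for s
    using integrable_mult_indicator_borel_leb_on[OF H, of "{s<..}"]
    by (rule Bochner_Integration.integrable_cong[THEN iffD1, rotated 2]) (auto simp: indicator_def)
  have split: "prim a b h x = (\<integral>r. (if r \<le> s then H r else 0) \<partial>?L) + (\<integral>r. (if s < r then H r else 0) \<partial>?L)" for s
  proof -
    have "prim a b h x = (\<integral>r. (if r \<le> s then H r else 0) + (if s < r then H r else 0) \<partial>?L)"
      unfolding prim_def H_def by (intro Bochner_Integration.integral_cong) auto
    then show ?thesis using ile ilt by simp
  qed
  have gh: "integrable ?L (\<lambda>s. g s * prim a b h s)" "integrable ?L (\<lambda>s. prim a b g s * h s)"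
    using integrable_mult_bounded[OF g prim_measurable[OF h] AE_I2[OF abs_prim_le[OF h]]]
          integrable_mult_bounded[OF h prim_measurable[OF g] AE_I2[OF abs_prim_le[OF g]]]
    by (simp_all add: mult.commute)
  have "prim a b g x * prim a b h x = (\<integral>s. G s * prim a b h x \<partial>?L)"
    by (simp add: G_def prim_def)
  also have "\<dots> = (\<integral>s. (g s * prim a b h s) * indicator {..x} s + (\<integral>r. K s r \<partial>?L) \<partial>?L)"
  proof (intro Bochner_Integration.integral_cong refl)
    fix s
    have "K s r = G s * (if s < r then H r else 0)" for r by (simp add: K_def)
    then have "(\<integral>r. K s r \<partial>?L) = G s * (\<integral>r. (if s < r then H r else 0) \<partial>?L)" by simp
    moreover have "prim a b h x = prim a b h s + (\<integral>r. (if s < r then H r else 0) \<partial>?L)" if "s \<le> x"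
      using split[of s] inner[of s] that by simp
    ultimately show "G s * prim a b h x = (g s * prim a b h s) * indicator {..x} s + (\<integral>r. K s r \<partial>?L)"
      by (cases "s \<le> x") (simp_all add: G_def distrib_left)
  qed
  also have "\<dots> = prim a b (\<lambda>s. g s * prim a b h s) x + (\<integral>s. (\<integral>r. K s r \<partial>?L) \<partial>?L)"
    unfolding prim_def[of a b "\<lambda>s. g s * prim a b h s"]
    using integrable_prim_integrand[OF gh(1)] LL.integrable_fst[OF K] by simp
  also have "(\<integral>s. (\<integral>r. K s r \<partial>?L) \<partial>?L) = (\<integral>r. (\<integral>s. K s r \<partial>?L) \<partial>?L)"
    using LL.Fubini_integral[OF K] by simp
  also have "\<dots> = prim a b (\<lambda>s. prim a b g s * h s) x"
    unfolding prim_def[of a b "\<lambda>s. prim a b g s * h s"]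
  proof (intro Bochner_Integration.integral_cong refl)
    fix r
    have "K s r = (if s < r then G s else 0) * H r" for s by (simp add: K_def)
    then have "(\<integral>s. K s r \<partial>?L) = (\<integral>s. (if s < r then G s else 0) \<partial>?L) * H r" by simp
    then show "(\<integral>s. K s r \<partial>?L) = (prim a b g r * h r) * indicator {..x} r"
      unfolding inner' by (auto simp: H_def indicator_def)
  qed
  finally show ?thesis using prim_add[OF gh] by simp
qed

section \<open>Weak derivatives in one dimension\<close>

lemma nonneg_if_AE_nonneg_on_Icc:
  assumes cd: "a \<le> c" "c < d" "d \<le> b" and f: "continuous_on {c..d} f"
    and ae: "AE x in leb_on a b. x \<in> {c..d} \<longrightarrow> 0 \<le> f x" and x: "x \<in> {c..d}"
  shows "0 \<le> (f x :: real)"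
proof (rule ccontr)
  assume "\<not> 0 \<le> f x"
  then have "f x < 0" by simp
  then have "\<forall>\<^sub>F y in at x within {c..d}. f y < 0"
    using f x by (intro order_tendstoD(2)[of f "f x"]) (auto simp: continuous_on_def)
  then obtain e where e: "e > 0" "\<And>y. y \<in> {c..d} \<Longrightarrow> y \<noteq> x \<Longrightarrow> dist y x < e \<Longrightarrow> f y < 0"
    unfolding eventually_at by blast
  define l where "l = max c (x - e)"
  define u where "u = min d (x + e)"
  have lu: "l < u" "c \<le> l" "u \<le> d" using cd x e by (auto simp: l_def u_def)
  have "AE y in leb_on a b. y \<notin> {l<..<u}"
    using ae AE_leb_on_neq[where c=x and a=a and b=b]
  proof eventually_elim
    fix y assume y: "y \<in> {c..d} \<longrightarrow> 0 \<le> f y" "y \<noteq> x"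
    show "y \<notin> {l<..<u}"
    proof
      assume "y \<in> {l<..<u}"
      then have "y \<in> {c..d}" "dist y x < e" by (auto simp: l_def u_def dist_real_def)
      with e(2)[of y] y show False by force
    qed
  qed
  then have "AE y in leb_on a b. indicator {l<..<u} y = (0::ennreal)" by eventually_elim simp
  then have "(\<integral>\<^sup>+y. indicator {l<..<u} y \<partial>leb_on a b) = (\<integral>\<^sup>+y. 0 \<partial>leb_on a b)"
    by (intro nn_integral_cong_AE) simp
  moreover have S: "{l<..<u} \<subseteq> {a..b}" using lu cd by auto
  moreover have "{l<..<u} \<in> sets (leb_on a b)" using S by (subst sets_restrict_space_iff) auto
  ultimately show False using lu(1) by (simp add: emeasure_leb_on)
qed

lemma integrable_leb_on_continuous:
  fixes f :: "real \<Rightarrow> real"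
  assumes "continuous_on UNIV f"
  shows "integrable (leb_on a b) f"
proof -
  interpret finite_measure "leb_on a b" by (rule finite_measure_leb_on)
  have "bounded (f ` {a..b})"
    using assms by (intro compact_imp_bounded compact_continuous_image) (auto intro: continuous_on_subset)
  then obtain B where "\<forall>x\<in>{a..b}. \<bar>f x\<bar> \<le> B" by (auto simp: bounded_iff)
  moreover have "f \<in> borel_measurable (leb_on a b)"
    using assms by (intro borel_measurable_leb_on borel_measurable_continuous_onI)
  ultimately show ?thesis
    by (intro integrable_const_bound[where B=B]) (auto simp: AE_restrict_space_iff)
qed

lemma prim_deriv_eq:
  assumes f: "\<And>x. (f has_real_derivative f' x) (at x)" and f': "continuous_on UNIV f'"
    and x: "x \<in> {a..b}"
  shows "prim a b f' x = f x - f a"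
proof -
  have "prim a b f' x = (\<integral>s. indicator {a..b} s *\<^sub>R (f' s * indicator {..x} s) \<partial>lborel)"
    unfolding prim_def by (subst integral_restrict_space) auto
  also have "\<dots> = (\<integral>s. f' s * indicator {a..x} s \<partial>lborel)"
    using x by (intro Bochner_Integration.integral_cong) (auto simp: indicator_def)
  also have "\<dots> = f x - f a"
    using x f f' by (intro integral_FTC_Icc_real) (auto simp: continuous_on_eq_continuous_at)
  finally show ?thesis .
qed

lemma test_funD:
  assumes "test_fun a b \<phi>"
  shows "(\<phi> has_real_derivative deriv \<phi> x) (at x)" "continuous_on UNIV (deriv \<phi>)" "\<phi> a = 0" "\<phi> b = 0"
proof -
  obtain D where D: "\<And>x. (\<phi> has_vector_derivative D x) (at x)" "continuous_on UNIV D"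
    using assms by (auto simp: test_fun_def C1_differentiable_on_def)
  then have r: "(\<phi> has_real_derivative D x) (at x)" for x
    by (simp add: has_real_derivative_iff_has_vector_derivative)
  then have "deriv \<phi> = D" by (auto intro: DERIV_imp_deriv)
  with r D show "(\<phi> has_real_derivative deriv \<phi> x) (at x)" "continuous_on UNIV (deriv \<phi>)" by auto
  have "x \<in> {a<..<b}" if "\<phi> x \<noteq> 0" for x
    using assms that closure_subset[of "{x. \<phi> x \<noteq> 0}"] by (auto simp: test_fun_def)
  from this[of a] this[of b] show "\<phi> a = 0" "\<phi> b = 0" by auto
qed

text \<open>
  A test function is the primitive of its derivative and vanishes at both endpoints, so this is
  integration by parts of two primitives.
\<close>

lemma has_weak_deriv_prim:
  assumes g: "integrable (leb_on a b) g" and u: "u \<in> borel_measurable (leb_on a b)"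
    and ae: "AE x in leb_on a b. u x = c + prim a b g x"
  shows "has_weak_deriv a b u g"
  unfolding has_weak_deriv_def
proof (intro conjI allI impI)
  have iU: "integrable (leb_on a b) (\<lambda>x. c + prim a b g x)"
    by (intro integrable_leb_on_continuous continuous_on_add continuous_on_const continuous_prim g)
  show iu: "integrable (leb_on a b) u"
    using ae by (intro integrable_cong_AE_imp[OF iU u]) auto
  show "integrable (leb_on a b) g" by fact
  fix \<phi> assume \<phi>: "test_fun a b \<phi>"
  note t = test_funD[OF \<phi>]
  have idp: "integrable (leb_on a b) (deriv \<phi>)" using t by (intro integrable_leb_on_continuous)
  have c\<phi>: "continuous_on UNIV \<phi>" using t(1) by (meson DERIV_isCont continuous_at_imp_continuous_on)
  have p: "prim a b (deriv \<phi>) x = \<phi> x" if "x \<in> {a..b}" for x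
    using prim_deriv_eq[OF t(1,2) that] t(3) by simp
  show "(\<integral>x. u x * deriv \<phi> x \<partial>leb_on a b) = - (\<integral>x. g x * \<phi> x \<partial>leb_on a b)"
  proof (cases "a \<le> b")
    case True
    have i1: "integrable (leb_on a b) (\<lambda>x. g x * prim a b (deriv \<phi>) x)"
      by (rule integrable_mult_bounded[OF g prim_measurable[OF idp] AE_I2[OF abs_prim_le[OF idp]]])
    have i2: "integrable (leb_on a b) (\<lambda>x. prim a b g x * deriv \<phi> x)"
      using integrable_mult_bounded[OF idp prim_measurable[OF g] AE_I2[OF abs_prim_le[OF g]]]
      by (simp add: mult.commute)
    have "0 = prim a b g b * prim a b (deriv \<phi>) b" using p[of b] True t(4) by simp
    also have "\<dots> = (\<integral>s. g s * prim a b (deriv \<phi>) s + prim a b g s * deriv \<phi> s \<partial>leb_on a b)"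
      using prim_prim_eq[OF g idp, of b] by (simp add: prim_right)
    also have "\<dots> = (\<integral>s. g s * prim a b (deriv \<phi>) s \<partial>leb_on a b) + (\<integral>s. prim a b g s * deriv \<phi> s \<partial>leb_on a b)"
      using i1 i2 by simp
    also have "(\<integral>s. g s * prim a b (deriv \<phi>) s \<partial>leb_on a b) = (\<integral>s. g s * \<phi> s \<partial>leb_on a b)"
      by (intro Bochner_Integration.integral_cong) (auto simp: p)
    finally have 1: "(\<integral>s. prim a b g s * deriv \<phi> s \<partial>leb_on a b) = - (\<integral>s. g s * \<phi> s \<partial>leb_on a b)" by simp
    have "(\<integral>x. u x * deriv \<phi> x \<partial>leb_on a b) = (\<integral>x. (c + prim a b g x) * deriv \<phi> x \<partial>leb_on a b)"
    proof (rule integral_cong_AE)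
      show "AE x in leb_on a b. u x * deriv \<phi> x = (c + prim a b g x) * deriv \<phi> x"
        using ae by eventually_elim simp
      show "(\<lambda>x. u x * deriv \<phi> x) \<in> borel_measurable (leb_on a b)" using u idp by measurable
      show "(\<lambda>x. (c + prim a b g x) * deriv \<phi> x) \<in> borel_measurable (leb_on a b)"
        using prim_measurable[OF g] idp by measurable
    qed
    also have "\<dots> = c * (\<integral>x. deriv \<phi> x \<partial>leb_on a b) + (\<integral>x. prim a b g x * deriv \<phi> x \<partial>leb_on a b)"
      using i2 idp by (simp add: distrib_right)
    also have "(\<integral>x. deriv \<phi> x \<partial>leb_on a b) = 0"
      using p[of b] True t(4) by (simp add: prim_right)
    finally show ?thesis using 1 by simp
  next
    case False
    have "(\<integral>x. f x \<partial>leb_on a b) = (\<integral>x. 0 \<partial>leb_on a b)" for f :: "real \<Rightarrow> real"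
      using False by (intro Bochner_Integration.integral_cong) auto
    then show ?thesis by (metis integral_zero neg_0_equal_iff_equal)
  qed
qed

text \<open>
  Having mean zero is what makes the primitive vanish again to the right of the support. This turns
  a statement about derivatives of test functions into one about arbitrary continuous functions.
\<close>

lemma test_fun_antiderivative:
  assumes ab: "a < c" "c \<le> d" "d < b"
    and \<eta>: "continuous_on UNIV \<eta>" and supp: "\<And>x. x \<notin> {c..d} \<Longrightarrow> \<eta> x = 0"
    and mean: "(\<integral>x. \<eta> x \<partial>leb_on a b) = 0"
  obtains \<phi> where "test_fun a b \<phi>" "deriv \<phi> = \<eta>"
proof -
  define \<phi> where "\<phi> = (\<lambda>x. integral {a..x} \<eta>)"
  have cont: "continuous_on S \<eta>" for S using \<eta> by (rule continuous_on_subset) simp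
  have z: "\<phi> x = 0" if "x \<le> c" for x
  proof -
    have "\<phi> x = integral {a..x} (\<lambda>_. 0)" unfolding \<phi>_def
      by (rule integral_spike[where S="{c}"]) (use supp that in \<open>auto simp: not_le\<close>)
    then show ?thesis by simp
  qed
  have der: "(\<phi> has_real_derivative \<eta> x) (at x)" for x
  proof (cases "x < c")
    case True
    have "((\<lambda>_. 0) has_real_derivative 0) (at x)" by simp
    then have "(\<phi> has_real_derivative 0) (at x)"
      by (rule has_field_derivative_transform_within_open[where S="{..<c}"]) (use True z in auto)
    then show ?thesis using supp[of x] True by simp
  next
    case False
    have "(\<phi> has_real_derivative \<eta> x) (at x within {a..x+1})"
      unfolding \<phi>_def by (rule integral_has_real_derivative) (use cont False ab in auto)
    moreover have "at x within {a..x+1} = at x"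
      by (rule at_within_interior) (use False ab in \<open>auto simp: interior_atLeastAtMost_real\<close>)
    ultimately show ?thesis by simp
  qed
  have z2: "\<phi> x = 0" if "d \<le> x" for x
  proof -
    have 1: "integral {a..y} \<eta> = prim a b \<eta> y" if "y \<in> {a..b}" for y
      using prim_deriv_eq[OF der \<eta> that] ab by (simp add: \<phi>_def)
    have b0: "\<phi> b = 0"
      using 1[of b] ab mean by (simp add: \<phi>_def prim_right)
    \<comment> \<open>The point \<open>x\<close> may lie on either side of \<open>b\<close>, where \<open>\<phi>\<close> is known to vanish.\<close>
    have s0: "integral {min x b..max x b} \<eta> = integral {min x b..max x b} (\<lambda>_. 0)"
      by (rule integral_spike[where S="{d}"]) (use supp that ab in \<open>auto simp: min_def not_le split: if_splits\<close>)
    have "integral {a..min x b} \<eta> + integral {min x b..max x b} \<eta> = integral {a..max x b} \<eta>"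
      by (rule Henstock_Kurzweil_Integration.integral_combine)
         (use that ab cont in \<open>auto intro: integrable_continuous_real\<close>)
    then show ?thesis using b0 s0 unfolding \<phi>_def by (auto simp: min_def max_def split: if_splits)
  qed
  have "x \<in> {c..d}" if "\<phi> x \<noteq> 0" for x
    using z[of x] z2[of x] that by (cases "x \<le> c"; cases "d \<le> x") auto
  then have "{x. \<phi> x \<noteq> 0} \<subseteq> {c..d}" by blast
  then have "closure {x. \<phi> x \<noteq> 0} \<subseteq> {c..d}" by (rule closure_minimal) simp
  also have "\<dots> \<subseteq> {a<..<b}" using ab by auto
  finally have "closure {x. \<phi> x \<noteq> 0} \<subseteq> {a<..<b}" .
  moreover have "\<phi> C1_differentiable_on UNIV"
    unfolding C1_differentiable_on_def using der \<eta>
    by (auto simp: has_real_derivative_iff_has_vector_derivative)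
  ultimately have "test_fun a b \<phi>" by (simp add: test_fun_def)
  moreover have "deriv \<phi> = \<eta>" using der by (auto intro: DERIV_imp_deriv)
  ultimately show ?thesis by (rule that)
qed

text \<open>
  Trapezoids: continuous functions that vanish within distance \<open>1/n\<close> of \<open>x\<close> and \<open>y\<close>, equal \<open>1\<close> at
  distance at least \<open>2/n\<close> inside, and converge to the indicator of \<open>(x, y)\<close>.
\<close>

definition trap :: "nat \<Rightarrow> real \<Rightarrow> real \<Rightarrow> real \<Rightarrow> real" where
  "trap n x y s = max 0 (min 1 (real n * min (s - x) (y - s) - 1))"

lemma trap_continuous: "continuous_on S (trap n x y)"
  unfolding trap_def by (intro continuous_intros)

lemma trap_bounds: "0 \<le> trap n x y s" "trap n x y s \<le> 1"
  by (auto simp: trap_def)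

lemma trap_supp:
  assumes "s \<notin> {x + 1 / real n..y - 1 / real n}" "n > 0"
  shows "trap n x y s = 0"
proof -
  have "min (s - x) (y - s) \<le> 1 / real n" using assms(1) by (auto simp: min_def)
  then have "real n * min (s - x) (y - s) \<le> 1" using assms(2) by (simp add: field_simps)
  then show ?thesis by (simp add: trap_def)
qed

lemma trap_tendsto: "(\<lambda>n. trap n x y s) \<longlonglongrightarrow> indicator {x<..<y} s"
proof (cases "s \<in> {x<..<y}")
  case True
  then have pos: "min (s - x) (y - s) > 0" by simp
  obtain N :: nat where N: "2 / min (s - x) (y - s) < real N" using reals_Archimedean2 by blast
  have "trap n x y s = 1" if "n \<ge> N" for n
  proof -
    have "2 / min (s - x) (y - s) < real n" using N that by linarith
    then have "real n * min (s - x) (y - s) > 2" using pos by (simp only: pos_divide_less_eq)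
    then show ?thesis by (simp add: trap_def)
  qed
  then show ?thesis using True by (intro tendsto_eventually) (auto simp: eventually_sequentially)
next
  case False
  have "trap n x y s = 0" for n
  proof -
    have "real n * min (s - x) (y - s) \<le> 0" using False by (intro mult_nonneg_nonpos) auto
    then show ?thesis by (simp add: trap_def)
  qed
  then show ?thesis using False by simp
qed

lemma integral_trap_tendsto:
  assumes v: "integrable (leb_on a b) v"
  shows "(\<lambda>n. \<integral>s. v s * trap n x y s \<partial>leb_on a b) \<longlonglongrightarrow> (\<integral>s. v s * indicator {x<..<y} s \<partial>leb_on a b)"
proof (rule integral_dominated_convergence)
  have m: "trap n x y \<in> borel_measurable (leb_on a b)" for n
    by (intro borel_measurable_leb_on borel_measurable_continuous_onI trap_continuous)
  show "(\<lambda>s. v s * indicator {x<..<y} s) \<in> borel_measurable (leb_on a b)"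
    using integrable_mult_indicator_borel_leb_on[OF v, of "{x<..<y}"] by simp
  show "(\<lambda>s. v s * trap n x y s) \<in> borel_measurable (leb_on a b)" for n using v m by measurable
  show "integrable (leb_on a b) (\<lambda>s. \<bar>v s\<bar>)" using v by simp
  show "AE s in leb_on a b. (\<lambda>n. v s * trap n x y s) \<longlonglongrightarrow> v s * indicator {x<..<y} s"
    by (intro AE_I2 tendsto_mult tendsto_const trap_tendsto)
  show "AE s in leb_on a b. norm (v s * trap n x y s) \<le> \<bar>v s\<bar>" for n
    using trap_bounds[of n x y] by (auto simp: abs_mult intro!: mult_left_le AE_I2)
qed

text \<open>
  The du Bois-Reymond lemma. Subtracting from a trapezoid the multiple of a fixed one \<open>\<psi>\<close> that has
  the same integral gives the derivative of a test function. Hence \<open>v\<close> integrates every trapezoid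
  as the constant \<open>K = \<integral> v \<psi> / \<integral> \<psi>\<close> does, and in the limit every interval.
\<close>

lemma AE_const_if_weak_deriv_zero:
  assumes "a < b" and v: "integrable (leb_on a b) v"
    and z: "\<And>\<phi>. test_fun a b \<phi> \<Longrightarrow> (\<integral>x. v x * deriv \<phi> x \<partial>leb_on a b) = 0"
  shows "\<exists>K. AE x in leb_on a b. v x = K"
proof -
  let ?L = "leb_on a b"
  interpret finite_measure ?L by (rule finite_measure_leb_on)
  have len: "(\<integral>s. indicator {x<..<y} s \<partial>?L) = (y - x :: real)" if "a \<le> x" "x \<le> y" "y \<le> b" for x y
  proof -
    have "emeasure ?L {x<..<y} = ennreal (y - x)" using that by (subst emeasure_leb_on) auto
    moreover have "{x<..<y} \<inter> {a..b} = {x<..<y}" using that by auto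
    ultimately show ?thesis using that by (simp add: measure_def)
  qed
  have it: "integrable ?L (trap n x y)" for n x y by (intro integrable_leb_on_continuous trap_continuous)
  have ivt: "integrable ?L (\<lambda>s. v s * trap n x y s)" for n x y
    using trap_bounds[of n x y] it[of n x y]
    by (intro integrable_mult_bounded[OF v, where B=1]) auto
  have lim1: "(\<lambda>n. \<integral>s. trap n x y s \<partial>?L) \<longlonglongrightarrow> (\<integral>s. indicator {x<..<y} s \<partial>?L)" for x y
    using integral_trap_tendsto[of a b "\<lambda>_. 1" x y] by simp
  have "\<forall>\<^sub>F n in sequentially. (\<integral>s. trap n a b s \<partial>?L) > 0"
    using order_tendstoD(1)[OF lim1[of a b], of 0] len[of a b] \<open>a < b\<close> by simp
  then have "\<forall>\<^sub>F n in sequentially. (\<integral>s. trap n a b s \<partial>?L) > 0 \<and> n > 0"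
    using eventually_gt_at_top by (rule eventually_conj)
  then obtain n0 where n0: "(\<integral>s. trap n0 a b s \<partial>?L) > 0" "n0 > 0"
    unfolding eventually_sequentially by blast
  define \<psi> where "\<psi> = trap n0 a b"
  define I where "I = (\<integral>s. \<psi> s \<partial>?L)"
  define K where "K = (\<integral>s. v s * \<psi> s \<partial>?L) / I"
  have I: "I > 0" using n0 by (simp add: I_def \<psi>_def)
  have key: "(\<integral>s. v s * trap n x y s \<partial>?L) = K * (\<integral>s. trap n x y s \<partial>?L)"
    if "a \<le> x" "y \<le> b" "n > 0" for n x y
  proof -
    define r where "r = (\<integral>s. trap n x y s \<partial>?L) / I"
    define \<eta> where "\<eta> = (\<lambda>s. trap n x y s - r * \<psi> s)"
    define N where "N = max n n0"
    have N: "N > 0" using that by (simp add: N_def)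
    have le: "1 / real N \<le> 1 / real n" "1 / real N \<le> 1 / real n0"
      using that n0 by (auto simp: N_def intro!: divide_left_mono)
    have supp: "\<eta> s = 0" if "s \<notin> {a + 1 / real N..b - 1 / real N}" for s
    proof -
      have "s \<notin> {x + 1 / real n..y - 1 / real n}" "s \<notin> {a + 1 / real n0..b - 1 / real n0}"
        using that le \<open>a \<le> x\<close> \<open>y \<le> b\<close> by auto
      then show ?thesis using trap_supp \<open>n > 0\<close> n0 by (simp add: \<eta>_def \<psi>_def)
    qed
    have i1: "integrable ?L \<psi>" "integrable ?L (\<lambda>s. v s * \<psi> s)" using it ivt by (auto simp: \<psi>_def)
    have mean: "(\<integral>s. \<eta> s \<partial>?L) = 0"
      unfolding \<eta>_def using it i1 I by (simp add: r_def I_def)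
    have cont: "continuous_on UNIV \<eta>"
      unfolding \<eta>_def \<psi>_def by (intro continuous_intros trap_continuous)
    have z\<eta>: "(\<integral>s. v s * \<eta> s \<partial>?L) = 0"
    proof (cases "a + 1 / real N \<le> b - 1 / real N")
      case True
      obtain \<phi> where "test_fun a b \<phi>" "deriv \<phi> = \<eta>"
        by (rule test_fun_antiderivative[of a "a + 1 / real N" "b - 1 / real N" b \<eta>])
           (use True N cont supp mean in auto)
      then show ?thesis using z[of \<phi>] by simp
    next
      case False
      then have "\<eta> s = 0" for s by (intro supp) auto
      then show ?thesis by simp
    qed
    have "(\<integral>s. v s * \<eta> s \<partial>?L) = (\<integral>s. v s * trap n x y s - r * (v s * \<psi> s) \<partial>?L)"
      unfolding \<eta>_def by (intro Bochner_Integration.integral_cong) (auto simp: algebra_simps)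
    also have "\<dots> = (\<integral>s. v s * trap n x y s \<partial>?L) - r * (\<integral>s. v s * \<psi> s \<partial>?L)"
      using ivt i1 by simp
    finally show ?thesis using z\<eta> by (simp add: r_def K_def)
  qed
  have int: "(\<integral>s. v s * indicator {x<..<y} s \<partial>?L) = K * (\<integral>s. indicator {x<..<y} s \<partial>?L)"
    if "a \<le> x" "y \<le> b" for x y
  proof (rule LIMSEQ_unique[OF integral_trap_tendsto[OF v]])
    have ev: "\<forall>\<^sub>F n in sequentially. K * (\<integral>s. trap n x y s \<partial>?L) = (\<integral>s. v s * trap n x y s \<partial>?L)"
      using eventually_gt_at_top[of 0] by eventually_elim (use key that in auto)
    show "(\<lambda>n. \<integral>s. v s * trap n x y s \<partial>?L) \<longlonglongrightarrow> K * (\<integral>s. indicator {x<..<y} s \<partial>?L)"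
      by (rule Lim_transform_eventually[OF tendsto_mult[OF tendsto_const lim1] ev])
  qed
  have "AE x in ?L. v x - K = 0"
  proof (rule AE_zero_if_interval_integrals_zero)
    show "integrable ?L (\<lambda>x. v x - K)" using v by simp
    fix x y assume xy: "a \<le> x" "x < y" "y \<le> b"
    have i: "integrable ?L (indicator {x<..<y} :: real \<Rightarrow> real)"
      using integrable_mult_indicator_borel_leb_on[of a b "\<lambda>_. 1" "{x<..<y}"] by simp
    have "(\<integral>s. (v s - K) * indicator {x<..<y} s \<partial>?L)
       = (\<integral>s. v s * indicator {x<..<y} s - K * indicator {x<..<y} s \<partial>?L)"
      by (intro Bochner_Integration.integral_cong) (auto simp: algebra_simps)
    also have "\<dots> = 0"
      using integrable_mult_indicator_borel_leb_on[OF v, of "{x<..<y}"] i int[of x y] xy by simp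
    finally show "(\<integral>s. (v s - K) * indicator {x<..<y} s \<partial>?L) = 0" .
  qed
  then have "AE x in ?L. v x = K" by eventually_elim simp
  then show ?thesis by blast
qed

lemma has_weak_derivD:
  assumes "has_weak_deriv a b u g"
  shows "integrable (leb_on a b) u" "integrable (leb_on a b) g"
    "test_fun a b \<phi> \<Longrightarrow> (\<integral>x. u x * deriv \<phi> x \<partial>leb_on a b) = - (\<integral>x. g x * \<phi> x \<partial>leb_on a b)"
  using assms by (auto simp: has_weak_deriv_def)

lemma has_weak_deriv_AE_eq_prim:
  assumes "a < b" and w: "has_weak_deriv a b u g"
  shows "\<exists>c. AE x in leb_on a b. u x = c + prim a b g x"
proof -
  let ?L = "leb_on a b"
  note D = has_weak_derivD[OF w]
  have ip: "integrable ?L (prim a b g)"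
    by (intro integrable_leb_on_continuous continuous_prim D)
  have wp: "has_weak_deriv a b (prim a b g) g"
    by (rule has_weak_deriv_prim[where c=0]) (use D ip in auto)
  have "\<exists>K. AE x in ?L. u x - prim a b g x = K"
  proof (rule AE_const_if_weak_deriv_zero[OF \<open>a < b\<close>])
    show "integrable ?L (\<lambda>x. u x - prim a b g x)" using D ip by simp
    fix \<phi> assume \<phi>: "test_fun a b \<phi>"
    have c: "continuous_on UNIV (deriv \<phi>)" by (rule test_funD[OF \<phi>])
    have "bounded (deriv \<phi> ` {a..b})"
      using c by (intro compact_imp_bounded compact_continuous_image) (auto intro: continuous_on_subset)
    then obtain B where "\<forall>x\<in>{a..b}. \<bar>deriv \<phi> x\<bar> \<le> B" by (auto simp: bounded_iff)
    then have B: "AE x in ?L. \<bar>deriv \<phi> x\<bar> \<le> B" by (auto simp: AE_restrict_space_iff)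
    have m: "deriv \<phi> \<in> borel_measurable ?L" using c by (intro borel_measurable_leb_on borel_measurable_continuous_onI)
    have "(\<integral>x. (u x - prim a b g x) * deriv \<phi> x \<partial>?L) = (\<integral>x. u x * deriv \<phi> x \<partial>?L) - (\<integral>x. prim a b g x * deriv \<phi> x \<partial>?L)"
      using integrable_mult_bounded[OF D(1) m B] integrable_mult_bounded[OF ip m B]
      by (simp add: left_diff_distrib)
    then show "(\<integral>x. (u x - prim a b g x) * deriv \<phi> x \<partial>?L) = 0"
      using D(3)[OF \<phi>] has_weak_derivD(3)[OF wp \<phi>] by simp
  qed
  then obtain K where "AE x in ?L. u x - prim a b g x = K" ..
  then have "AE x in ?L. u x = K + prim a b g x" by eventually_elim simp
  then show ?thesis ..
qed

lemma has_weak_deriv_cong_AE: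
  assumes w: "has_weak_deriv a b u g" and u': "integrable (leb_on a b) u'"
    and ae: "AE x in leb_on a b. u x = u' x"
  shows "has_weak_deriv a b u' g"
  unfolding has_weak_deriv_def
proof (intro conjI allI impI)
  fix \<phi> assume \<phi>: "test_fun a b \<phi>"
  have m: "deriv \<phi> \<in> borel_measurable (leb_on a b)"
    using test_funD(2)[OF \<phi>] by (intro borel_measurable_leb_on borel_measurable_continuous_onI)
  note D = has_weak_derivD[OF w]
  have "(\<integral>x. u' x * deriv \<phi> x \<partial>leb_on a b) = (\<integral>x. u x * deriv \<phi> x \<partial>leb_on a b)"
  proof (rule integral_cong_AE)
    show "AE x in leb_on a b. u' x * deriv \<phi> x = u x * deriv \<phi> x" using ae by eventually_elim simp
  qed (use m D(1) u' in measurable)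
  then show "(\<integral>x. u' x * deriv \<phi> x \<partial>leb_on a b) = - (\<integral>x. g x * \<phi> x \<partial>leb_on a b)"
    using D(3)[OF \<phi>] by simp
qed (use u' has_weak_derivD[OF w] in auto)

text \<open>
  The primitives of two weak derivatives differ by a constant almost everywhere, hence everywhere on
  \<open>[a, b]\<close> by continuity, so the two derivatives have the same integral over every interval.
\<close>

lemma has_weak_deriv_unique:
  assumes "a < b" and g: "has_weak_deriv a b u g" and h: "has_weak_deriv a b u h"
  shows "AE x in leb_on a b. g x = h x"
proof -
  let ?L = "leb_on a b"
  note ig = has_weak_derivD(2)[OF g] and ih = has_weak_derivD(2)[OF h]
  obtain c d where c: "AE x in ?L. u x = c + prim a b g x" and d: "AE x in ?L. u x = d + prim a b h x"
    using has_weak_deriv_AE_eq_prim[OF \<open>a < b\<close>] g h by blast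
  let ?f = "\<lambda>x. (c + prim a b g x) - (d + prim a b h x)"
  have cont: "continuous_on {a..b} ?f"
    by (intro continuous_intros continuous_on_subset[OF continuous_prim[OF ig]] continuous_on_subset[OF continuous_prim[OF ih]]) auto
  have ae: "AE x in ?L. ?f x = 0" using c d by eventually_elim simp
  have f0: "?f x = 0" if "x \<in> {a..b}" for x
  proof -
    have "0 \<le> ?f x"
      by (rule nonneg_if_AE_nonneg_on_Icc[of a a b b ?f]) (use \<open>a < b\<close> cont ae that in auto)
    moreover have "0 \<le> - ?f x"
      by (rule nonneg_if_AE_nonneg_on_Icc[of a a b b "\<lambda>x. - ?f x"])
         (use \<open>a < b\<close> continuous_on_minus[OF cont] ae that in auto)
    ultimately show ?thesis by simp
  qed
  have "AE x in ?L. g x - h x = 0"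
  proof (rule AE_zero_if_interval_integrals_zero)
    show i: "integrable ?L (\<lambda>x. g x - h x)" using ig ih by simp
    fix x y assume xy: "a \<le> x" "x < y" "y \<le> b"
    show "(\<integral>s. (g s - h s) * indicator {x<..<y} s \<partial>?L) = 0"
      using prim_diff_eq[OF i, of x y] f0[of x] f0[of y] xy by (simp add: prim_diff[OF ig ih])
  qed
  then show ?thesis by eventually_elim simp
qed

lemma has_weak_deriv_wderiv: "u \<in> W11 a b \<Longrightarrow> has_weak_deriv a b u (wderiv a b u)"
  unfolding W11_def wderiv_def by (metis (mono_tags) mem_Collect_eq someI_ex)

lemma W11_AE_bounded:
  assumes "a < b" "u \<in> W11 a b"
  shows "\<exists>B\<ge>0. AE x in leb_on a b. \<bar>u x\<bar> \<le> B"
proof -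
  obtain g where g: "has_weak_deriv a b u g" using assms by (auto simp: W11_def)
  then obtain c where c: "AE x in leb_on a b. u x = c + prim a b g x"
    using has_weak_deriv_AE_eq_prim[OF \<open>a < b\<close>] by blast
  let ?B = "\<bar>c\<bar> + (\<integral>s. \<bar>g s\<bar> \<partial>leb_on a b)"
  have "AE x in leb_on a b. \<bar>u x\<bar> \<le> ?B"
    using c
  proof eventually_elim
    fix x assume "u x = c + prim a b g x"
    then show "\<bar>u x\<bar> \<le> ?B" using abs_prim_le[OF has_weak_derivD(2)[OF g], of x] by linarith
  qed
  moreover have "?B \<ge> 0" by simp
  ultimately show ?thesis by blast
qed

lemma W11_continuous_representative:
  assumes "a < b" "u \<in> W11 a b"
  obtains v where "continuous_on UNIV v" "AE x in leb_on a b. u x = v x"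
proof -
  obtain g where g: "has_weak_deriv a b u g" using assms by (auto simp: W11_def)
  then obtain c where c: "AE x in leb_on a b. u x = c + prim a b g x"
    using has_weak_deriv_AE_eq_prim[OF \<open>a < b\<close>] by blast
  show ?thesis
    by (rule that[of "\<lambda>x. c + prim a b g x"])
       (use c in \<open>auto intro!: continuous_intros continuous_prim has_weak_derivD(2)[OF g]\<close>)
qed

lemma W11_mult:
  assumes "a < b" "u \<in> W11 a b" "v \<in> W11 a b"
  shows "(\<lambda>x. u x * v x) \<in> W11 a b"
proof -
  let ?L = "leb_on a b"
  obtain g h where g: "has_weak_deriv a b u g" and h: "has_weak_deriv a b v h"
    using assms by (auto simp: W11_def)
  note ig = has_weak_derivD(2)[OF g] and ih = has_weak_derivD(2)[OF h]
  obtain c d where c: "AE x in ?L. u x = c + prim a b g x" and d: "AE x in ?L. v x = d + prim a b h x"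
    using has_weak_deriv_AE_eq_prim[OF \<open>a < b\<close>] g h by blast
  define k where "k = (\<lambda>s. g s * prim a b h s + prim a b g s * h s)"
  have ik: "integrable ?L k"
    unfolding k_def
    using integrable_mult_bounded[OF ig prim_measurable[OF ih] AE_I2[OF abs_prim_le[OF ih]]]
          integrable_mult_bounded[OF ih prim_measurable[OF ig] AE_I2[OF abs_prim_le[OF ig]]]
    by (simp add: mult.commute)
  define f where "f = (\<lambda>s. (d * g s + c * h s) + k s)"
  have ic: "integrable ?L (\<lambda>s. d * g s)" "integrable ?L (\<lambda>s. c * h s)" using ig ih by auto
  have i: "integrable ?L f" unfolding f_def using ic ik by simp
  have eq: "(c + prim a b g x) * (d + prim a b h x) = c * d + prim a b f x" for x
  proof -
    have "prim a b f x = d * prim a b g x + c * prim a b h x + prim a b g x * prim a b h x"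
      unfolding f_def prim_prim_eq[OF ig ih] using ic ik by (simp add: prim_add prim_cmult k_def[symmetric])
    then show ?thesis by (simp add: algebra_simps)
  qed
  have "has_weak_deriv a b (\<lambda>x. u x * v x) f"
  proof (rule has_weak_deriv_prim[OF i])
    show "(\<lambda>x. u x * v x) \<in> borel_measurable ?L"
      using has_weak_derivD(1)[OF g] has_weak_derivD(1)[OF h] by measurable
    show "AE x in ?L. u x * v x = c * d + prim a b f x"
      using c d by eventually_elim (simp add: eq)
  qed
  then show ?thesis by (auto simp: W11_def)
qed

text \<open>
  Monotonicity passes to the continuous representative \<open>U\<close>, so \<open>g\<close> has nonnegative integrals over
  intervals. The second claim is an inequality because \<open>u\<close> may jump at the endpoints, which \<open>U\<close>
  does not see.
\<close>

lemma has_weak_deriv_mono: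
  assumes "a < b" and mono: "mono_on {a..b} u" and w: "has_weak_deriv a b u g"
  shows "AE x in leb_on a b. 0 \<le> g x" "(\<integral>x. g x \<partial>leb_on a b) \<le> u b - u a"
proof -
  let ?L = "leb_on a b"
  note ig = has_weak_derivD(2)[OF w]
  obtain c where c: "AE x in ?L. u x = c + prim a b g x"
    using has_weak_deriv_AE_eq_prim[OF \<open>a < b\<close> w] by blast
  define U where "U = (\<lambda>x. c + prim a b g x)"
  have U: "AE x in ?L. u x = U x \<and> x \<in> {a..b}"
    using c AE_space[of ?L] by eventually_elim (simp add: U_def)
  have cont: "continuous_on S U" for S
    unfolding U_def by (intro continuous_intros continuous_on_subset[OF continuous_prim[OF ig]]) auto
  have right: "U x \<le> U y" if "u x = U x" "x \<in> {a..b}" "y \<in> {x..b}" for x y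
  proof (cases "x = b")
    case False
    have "0 \<le> U y - U x"
    proof (rule nonneg_if_AE_nonneg_on_Icc[of a x b b "\<lambda>y. U y - U x"])
      show "AE y in ?L. y \<in> {x..b} \<longrightarrow> 0 \<le> U y - U x"
        using U
      proof eventually_elim
        fix y assume "u y = U y \<and> y \<in> {a..b}"
        then show "y \<in> {x..b} \<longrightarrow> 0 \<le> U y - U x"
          using that mono_onD[OF mono, of x y] by auto
      qed
    qed (use that False cont in \<open>auto intro!: continuous_intros\<close>)
    then show ?thesis by simp
  qed (use that in auto)
  have Umono: "U x \<le> U y" if "a \<le> x" "x < y" "y \<le> b" for x y
  proof -
    have "0 \<le> U y - U x"
    proof (rule nonneg_if_AE_nonneg_on_Icc[of a a y b "\<lambda>x. U y - U x"])
      show "AE x in ?L. x \<in> {a..y} \<longrightarrow> 0 \<le> U y - U x"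
        using U by eventually_elim (use that right in auto)
    qed (use that cont in \<open>auto intro!: continuous_intros\<close>)
    then show ?thesis by simp
  qed
  show "AE x in ?L. 0 \<le> g x"
  proof (rule AE_nonneg_if_interval_integrals_nonneg[OF ig])
    fix x y assume xy: "a \<le> x" "x < y" "y \<le> b"
    show "0 \<le> (\<integral>s. g s * indicator {x<..<y} s \<partial>?L)"
      using prim_diff_eq[OF ig, of x y] Umono[OF xy] xy by (simp add: U_def)
  qed
  have "0 \<le> u b - U b"
  proof (rule nonneg_if_AE_nonneg_on_Icc[of a a b b "\<lambda>x. u b - U x"])
    show "AE x in ?L. x \<in> {a..b} \<longrightarrow> 0 \<le> u b - U x"
      using U
    proof eventually_elim
      fix x assume "u x = U x \<and> x \<in> {a..b}"
      then show "x \<in> {a..b} \<longrightarrow> 0 \<le> u b - U x"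
        using mono \<open>a < b\<close> mono_onD[of "{a..b}" u x b] by auto
    qed
  qed (use \<open>a < b\<close> cont in \<open>auto intro!: continuous_intros\<close>)
  moreover have "0 \<le> U a - u a"
  proof (rule nonneg_if_AE_nonneg_on_Icc[of a a b b "\<lambda>x. U x - u a"])
    show "AE x in ?L. x \<in> {a..b} \<longrightarrow> 0 \<le> U x - u a"
      using U
    proof eventually_elim
      fix x assume "u x = U x \<and> x \<in> {a..b}"
      then show "x \<in> {a..b} \<longrightarrow> 0 \<le> U x - u a"
        using mono \<open>a < b\<close> mono_onD[of "{a..b}" u a x] by auto
    qed
  qed (use \<open>a < b\<close> cont in \<open>auto intro!: continuous_intros\<close>)
  ultimately show "(\<integral>x. g x \<partial>leb_on a b) \<le> u b - u a"
    by (simp add: U_def prim_left[OF ig] prim_right)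
qed

lemma has_weak_deriv_cmult:
  "has_weak_deriv a b u g \<Longrightarrow> has_weak_deriv a b (\<lambda>x. t * u x) (\<lambda>x. t * g x)"
  by (auto simp: has_weak_deriv_def mult.assoc)

lemma W21_cmult: "u \<in> W21 a b \<Longrightarrow> (\<lambda>x. t * u x) \<in> W21 a b"
  by (auto simp: W21_def W11_def dest: has_weak_deriv_cmult)

lemma W21_subset_W11: "W21 a b \<subseteq> W11 a b"
  by (auto simp: W21_def W11_def)

lemma wderiv_W21:
  assumes "a < b" "w \<in> W21 a b"
  shows "wderiv a b w \<in> W11 a b"
proof -
  obtain g h where g: "has_weak_deriv a b w g" and h: "has_weak_deriv a b g h"
    using assms by (auto simp: W21_def W11_def)
  have w: "has_weak_deriv a b w (wderiv a b w)"
    using g by (intro has_weak_deriv_wderiv) (auto simp: W11_def)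
  have "has_weak_deriv a b (wderiv a b w) h"
    by (rule has_weak_deriv_cong_AE[OF h has_weak_derivD(2)[OF w] has_weak_deriv_unique[OF \<open>a < b\<close> g w]])
  then show ?thesis by (auto simp: W11_def)
qed

section \<open>Bounds for the entropy\<close>

lemma emeasure_leb_on_space: "a \<le> b \<Longrightarrow> emeasure (leb_on a b) {a..b} = ennreal (b - a)"
  by (simp add: emeasure_leb_on)

lemma Ent_ge:
  assumes "a \<le> b"
  shows "ereal (- (b - a)) \<le> Ent a b \<nu>"
proof (cases "absolutely_continuous (leb_on a b) \<nu>")
  case True
  define P where "P = (\<integral>\<^sup>+ x. ennreal (dens a b \<nu> x * ln (dens a b \<nu> x)) \<partial>leb_on a b)"
  define N where "N = (\<integral>\<^sup>+ x. ennreal (- (dens a b \<nu> x * ln (dens a b \<nu> x))) \<partial>leb_on a b)"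
  have "- (p * ln p) \<le> 1" if "0 \<le> p" for p :: real
  proof (cases "p = 0")
    case False
    then have p: "p > 0" using that by simp
    have "- ln p \<le> 1 / p - 1" using ln_le_minus_one[of "1 / p"] p by (simp add: ln_div)
    then have "p * (- ln p) \<le> p * (1 / p - 1)" using p by (intro mult_left_mono) auto
    moreover have "p * (1 / p - 1) = 1 - p" using p by (simp add: field_simps)
    ultimately show ?thesis using p by simp
  qed simp
  then have "N \<le> (\<integral>\<^sup>+ x. ennreal 1 \<partial>leb_on a b)"
    unfolding N_def by (intro nn_integral_mono ennreal_leI) (auto simp: dens_def)
  also have "\<dots> = ennreal (b - a)" using assms by (simp add: emeasure_leb_on_space)
  finally have "enn2ereal N \<le> ereal (b - a)" using assms
    by (metis diff_ge_0_iff_ge enn2ereal_ennreal less_eq_ennreal.rep_eq)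
  then have "ereal 0 - ereal (b - a) \<le> enn2ereal P - enn2ereal N"
    by (intro ereal_minus_mono) (auto simp: zero_ereal_def[symmetric])
  then show ?thesis using True by (simp add: Ent_def P_def N_def)
qed (simp add: Ent_def)

text \<open>
  A measure dominated by \<open>K\<close> times Lebesgue measure has density at most \<open>K\<close>, which bounds the
  positive part of the entropy integral.
\<close>

lemma Ent_less_infinity:
  assumes sets: "sets \<nu> = sets (leb_on a b)"
    and bound: "\<And>A. A \<in> sets (leb_on a b) \<Longrightarrow> emeasure \<nu> A \<le> ennreal K * emeasure (leb_on a b) A"
  shows "Ent a b \<nu> < \<infinity>"
proof -
  let ?L = "leb_on a b"
  interpret L: finite_measure ?L by (rule finite_measure_leb_on)
  have ac: "absolutely_continuous ?L \<nu>"
    unfolding absolutely_continuous_def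
  proof
    fix A assume A: "A \<in> null_sets ?L"
    then have "A \<in> sets ?L" "emeasure ?L A = 0" by auto
    then show "A \<in> null_sets \<nu>" using bound[of A] sets by auto
  qed
  define R where "R = RN_deriv ?L \<nu>"
  have [measurable]: "R \<in> borel_measurable ?L" by (simp add: R_def)
  have dR: "density ?L R = \<nu>" unfolding R_def by (rule L.density_RN_deriv[OF ac sets])
  define A where "A = {x\<in>space ?L. R x > ennreal K}"
  have A[measurable]: "A \<in> sets ?L" unfolding A_def by measurable
  have "(\<integral>\<^sup>+x. (R x - ennreal K) * indicator A x \<partial>?L) + ennreal K * emeasure ?L A
      = (\<integral>\<^sup>+x. (R x - ennreal K) * indicator A x + ennreal K * indicator A x \<partial>?L)"
    by (subst nn_integral_add) (auto simp: nn_integral_cmult_indicator)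
  also have "\<dots> = (\<integral>\<^sup>+x. R x * indicator A x \<partial>?L)"
    by (intro nn_integral_cong) (auto simp: A_def indicator_def diff_add_cancel_ennreal)
  also have "\<dots> = emeasure \<nu> A" unfolding dR[symmetric] by (subst emeasure_density) auto
  also have "\<dots> \<le> ennreal K * emeasure ?L A" by (rule bound[OF A])
  finally have "(\<integral>\<^sup>+x. (R x - ennreal K) * indicator A x \<partial>?L) + ennreal K * emeasure ?L A \<le> 0 + ennreal K * emeasure ?L A"
    by simp
  moreover have "ennreal K * emeasure ?L A < top"
  proof -
    have "emeasure ?L A < top" using L.emeasure_finite[of A] by (metis infinity_ennreal_def less_top)
    then show ?thesis by (simp add: ennreal_mult_less_top)
  qed
  ultimately have "(\<integral>\<^sup>+x. (R x - ennreal K) * indicator A x \<partial>?L) \<le> 0"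
    by (auto simp: ennreal_add_left_cancel_le add.commute)
  then have "AE x in ?L. (R x - ennreal K) * indicator A x = 0"
    by (subst nn_integral_0_iff_AE[symmetric]) auto
  then have R: "AE x in ?L. R x \<le> ennreal K"
    using AE_space[of ?L]
  proof eventually_elim
    fix x assume x: "(R x - ennreal K) * indicator A x = 0" "x \<in> space ?L"
    show "R x \<le> ennreal K"
    proof (rule ccontr)
      assume "\<not> R x \<le> ennreal K"
      then have "x \<in> A" "R x - ennreal K \<noteq> 0" using x(2) by (auto simp: A_def diff_eq_0_iff_ennreal)
      then show False using x by simp
    qed
  qed
  have bd: "p * ln p \<le> \<bar>K\<bar> * \<bar>ln K\<bar>" if p: "0 \<le> p" "p \<le> max 0 K" for p
  proof (cases "p = 0")
    case False
    then have "p > 0" "p \<le> K" using p by auto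
    then have "p * ln p \<le> p * \<bar>ln K\<bar>" by (intro mult_left_mono) (auto intro!: order_trans[OF ln_mono abs_ge_self])
    also have "\<dots> \<le> \<bar>K\<bar> * \<bar>ln K\<bar>" using \<open>p \<le> K\<close> by (intro mult_right_mono) auto
    finally show ?thesis .
  qed simp
  define P where "P = (\<integral>\<^sup>+ x. ennreal (dens a b \<nu> x * ln (dens a b \<nu> x)) \<partial>?L)"
  define N where "N = (\<integral>\<^sup>+ x. ennreal (- (dens a b \<nu> x * ln (dens a b \<nu> x))) \<partial>?L)"
  have "P \<le> (\<integral>\<^sup>+ x. ennreal (\<bar>K\<bar> * \<bar>ln K\<bar>) \<partial>?L)"
    unfolding P_def
  proof (rule nn_integral_mono_AE)
    show "AE x in ?L. ennreal (dens a b \<nu> x * ln (dens a b \<nu> x)) \<le> ennreal (\<bar>K\<bar> * \<bar>ln K\<bar>)"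
      using R
    proof eventually_elim
      fix x assume "R x \<le> ennreal K"
      also have "\<dots> \<le> ennreal (max 0 K)" by (intro ennreal_leI) simp
      finally have "dens a b \<nu> x \<le> max 0 K"
        unfolding dens_def R_def[symmetric] by (intro enn2real_leI) auto
      then show "ennreal (dens a b \<nu> x * ln (dens a b \<nu> x)) \<le> ennreal (\<bar>K\<bar> * \<bar>ln K\<bar>)"
        by (intro ennreal_leI bd) (auto simp: dens_def)
    qed
  qed
  also have "\<dots> < \<infinity>"
    by (simp add: ennreal_mult_less_top emeasure_leb_on emeasure_lborel_Icc_eq)
  finally have "P < \<infinity>" .
  then have "enn2ereal P < \<infinity>" by (cases P) auto
  moreover have "0 \<le> enn2ereal N" by simp
  ultimately have "enn2ereal P - enn2ereal N < \<infinity>"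
    by (cases "enn2ereal P"; cases "enn2ereal N") auto
  then show ?thesis using ac by (simp add: Ent_def P_def N_def)
qed

section \<open>The Helly space\<close>

lemma HellyD:
  assumes "\<Phi> \<in> Helly a b"
  shows "mono_on {a..b} \<Phi>" "\<Phi> a = a" "\<Phi> b = b" "x \<in> {a..b} \<Longrightarrow> a \<le> \<Phi> x" "x \<in> {a..b} \<Longrightarrow> \<Phi> x \<le> b"
    "\<Phi> \<in> borel_measurable (leb_on a b)" "\<Phi> \<in> measurable (leb_on a b) (leb_on a b)"
proof -
  have f: "\<Phi> \<in> {a..b} \<rightarrow>\<^sub>E {a..b}" using assms by (simp add: Helly_def)
  show m: "mono_on {a..b} \<Phi>" and "\<Phi> a = a" "\<Phi> b = b" using assms by (auto simp: Helly_def)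
  show "x \<in> {a..b} \<Longrightarrow> a \<le> \<Phi> x" "x \<in> {a..b} \<Longrightarrow> \<Phi> x \<le> b" using f by auto
  have "\<Phi> \<in> borel_measurable (restrict_space borel {a..b})"
    by (rule borel_measurable_mono_on_fnc[OF m])
  then show *: "\<Phi> \<in> borel_measurable (leb_on a b)"
    by (subst measurable_cong_sets[OF sets_leb_on refl])
  show "\<Phi> \<in> measurable (leb_on a b) (leb_on a b)"
    using * f by (intro measurable_restrict_space2) auto
qed

lemma HellyI:
  assumes "mono_on {a..b} \<Phi>" "\<Phi> a = a" "\<Phi> b = b" "a \<le> b"
  shows "restrict \<Phi> {a..b} \<in> Helly a b"
proof -
  have "a \<le> \<Phi> x" "\<Phi> x \<le> b" if "x \<in> {a..b}" for x
    using mono_onD[OF assms(1), of a x] mono_onD[OF assms(1), of x b] assms that by auto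
  then show ?thesis using assms by (auto simp: Helly_def mono_on_def)
qed

section \<open>First order expansion of the entropic functional\<close>

locale bounded_density =
  fixes a b :: real and \<mu> :: "real measure"
  assumes ab: "a < b"
    and sets_mu: "sets \<mu> = sets (restrict_space borel {a..b})"
    and prob: "prob_space \<mu>"
    and ac: "absolutely_continuous (leb_on a b) \<mu>"
    and W11_dens: "dens a b \<mu> \<in> W11 a b"
    and essinf_pos: "0 < essinf (leb_on a b) (RN_deriv (leb_on a b) \<mu>)"
    and esssup_fin: "esssup (leb_on a b) (RN_deriv (leb_on a b) \<mu>) < \<infinity>"
begin

abbreviation "L \<equiv> leb_on a b"
abbreviation "m \<equiv> dens a b \<mu>"

sublocale P: prob_space \<mu> by (rule prob)
sublocale L: finite_measure L by (rule finite_measure_leb_on)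

lemma sets_mu_L: "sets \<mu> = sets L"
  by (simp add: sets_mu sets_leb_on)

lemma space_mu [simp]: "space \<mu> = {a..b}"
  using sets_eq_imp_space_eq[OF sets_mu_L] by simp

lemma measurable_mu: "measurable \<mu> N = measurable L N"
  by (rule measurable_cong_sets[OF sets_mu_L refl])

lemma AE_mu: "AE x in L. Q x \<Longrightarrow> AE x in \<mu>. Q x"
  by (rule absolutely_continuous_AE[OF sets_mu_L ac])

lemma m_measurable: "m \<in> borel_measurable L"
  unfolding dens_def by measurable

lemma m_nonneg: "0 \<le> m x"
  by (simp add: dens_def)

lemma m_bounded: "\<exists>M>0. AE x in L. RN_deriv L \<mu> x = ennreal (m x) \<and> m x \<le> M \<and> 0 < m x"
proof -
  define S where "S = esssup L (RN_deriv L \<mu>)"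
  have "AE x in L. RN_deriv L \<mu> x > 0"
    using essinf_pos unfolding essinf_def by (auto intro!: less_LiminfD split: if_splits)
  moreover have "AE x in L. RN_deriv L \<mu> x \<le> S" unfolding S_def by (rule esssup_AE)
  ultimately have "AE x in L. RN_deriv L \<mu> x = ennreal (m x) \<and> m x \<le> max 1 (enn2real S) \<and> 0 < m x"
  proof eventually_elim
    fix x assume x: "RN_deriv L \<mu> x > 0" "RN_deriv L \<mu> x \<le> S"
    have S: "S < top" using esssup_fin by (simp add: S_def)
    then have "RN_deriv L \<mu> x < top" using x by (rule_tac le_less_trans)
    moreover have "m x \<le> max 1 (enn2real S)"
      unfolding dens_def by (rule max.coboundedI2[OF enn2real_mono[OF x(2) S]])
    ultimately show "RN_deriv L \<mu> x = ennreal (m x) \<and> m x \<le> max 1 (enn2real S) \<and> 0 < m x"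
      using x(1) by (simp add: dens_def enn2real_positive_iff)
  qed
  then show ?thesis by (intro exI[of _ "max 1 (enn2real S)"]) auto
qed

text \<open>An almost everywhere upper bound for the density of \<open>\<mu>\<close>, fixed so that later bounds can refer to it.\<close>

definition "dens_bound = (SOME M. M > 0 \<and> (AE x in L. RN_deriv L \<mu> x = ennreal (m x) \<and> m x \<le> M \<and> 0 < m x))"

lemma dens_bound: "dens_bound > 0" "AE x in L. RN_deriv L \<mu> x = ennreal (m x) \<and> m x \<le> dens_bound \<and> 0 < m x"
  using someI_ex[OF m_bounded, folded dens_bound_def] by blast+

lemma m_AE_bound: "AE x in L. \<bar>m x\<bar> \<le> dens_bound"
  using dens_bound(2) by eventually_elim (auto simp: m_nonneg)

lemma integral_mu:
  fixes f :: "real \<Rightarrow> real"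
  assumes "f \<in> borel_measurable L"
  shows "(\<integral>x. f x \<partial>\<mu>) = (\<integral>x. m x * f x \<partial>L)"
  using L.RN_deriv_integral[OF _ ac sets_mu_L assms] P.sigma_finite_measure_axioms by (simp add: dens_def)

lemma integrable_mu:
  fixes f :: "real \<Rightarrow> real"
  assumes "integrable L f"
  shows "integrable \<mu> f"
proof -
  have "integrable L (\<lambda>x. m x * f x)"
    using integrable_mult_bounded[OF assms m_measurable m_AE_bound] by (simp add: mult.commute)
  then show ?thesis
    using L.RN_deriv_integrable[OF _ ac sets_mu_L borel_measurable_integrable[OF assms]] P.sigma_finite_measure_axioms
    by (simp add: dens_def)
qed

lemma emeasure_mu_le:
  assumes A: "A \<in> sets L"
  shows "emeasure \<mu> A \<le> ennreal dens_bound * emeasure L A"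
proof -
  have "emeasure \<mu> A = emeasure (density L (RN_deriv L \<mu>)) A"
    by (simp add: L.density_RN_deriv[OF ac sets_mu_L])
  also have "\<dots> = (\<integral>\<^sup>+x. RN_deriv L \<mu> x * indicator A x \<partial>L)"
    using A by (intro emeasure_density) auto
  also have "\<dots> \<le> (\<integral>\<^sup>+x. ennreal dens_bound * indicator A x \<partial>L)"
  proof (rule nn_integral_mono_AE)
    show "AE x in L. RN_deriv L \<mu> x * indicator A x \<le> ennreal dens_bound * indicator A x"
      using dens_bound(2) by eventually_elim (auto simp: indicator_def intro: ennreal_leI)
  qed
  also have "\<dots> = ennreal dens_bound * emeasure L A"
    using A by (intro nn_integral_cmult_indicator)
  finally show ?thesis .
qed

lemma measure_mu_interval_pos:
  assumes "a \<le> x" "x < y" "y \<le> b"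
  shows "0 < measure \<mu> {x..y}"
proof -
  have S: "{x..y} \<in> sets L" using assms by (subst sets_restrict_space_iff) auto
  have "emeasure \<mu> {x..y} \<noteq> 0"
  proof
    assume "emeasure \<mu> {x..y} = 0"
    then have "emeasure (density L (RN_deriv L \<mu>)) {x..y} = 0"
      by (simp add: L.density_RN_deriv[OF ac sets_mu_L])
    then have "(\<integral>\<^sup>+s. RN_deriv L \<mu> s * indicator {x..y} s \<partial>L) = 0"
      using S by (subst (asm) emeasure_density) auto
    then have "AE s in L. RN_deriv L \<mu> s * indicator {x..y} s = 0"
      using S by (subst (asm) nn_integral_0_iff_AE) auto
    then have "AE s in L. indicator {x..y} s = (0::ennreal)"
      using dens_bound(2) by eventually_elim (auto simp: indicator_def)
    then have "(\<integral>\<^sup>+s. indicator {x..y} s \<partial>L) = (\<integral>\<^sup>+s. 0 \<partial>L)" by (intro nn_integral_cong_AE) simp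
    then have "emeasure L {x..y} = 0" using S by simp
    then show False using assms by (simp add: emeasure_leb_on)
  qed
  then show ?thesis by (simp add: P.emeasure_eq_measure zero_less_measure_iff)
qed

definition "abs_bound = \<bar>a\<bar> + \<bar>b\<bar>"

lemma Helly_abs_le: "\<Phi> \<in> Helly a b \<Longrightarrow> x \<in> {a..b} \<Longrightarrow> \<bar>\<Phi> x\<bar> \<le> abs_bound"
  using HellyD(4,5)[of \<Phi> a b x] by (auto simp: abs_bound_def)

lemma Helly_AE_abs_le: "\<Phi> \<in> Helly a b \<Longrightarrow> AE x in L. \<bar>\<Phi> x\<bar> \<le> abs_bound"
  using AE_space[of L] by eventually_elim (auto intro: Helly_abs_le)

lemma integrable_Helly_mult:
  assumes "\<Phi> \<in> Helly a b" "integrable L w"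
  shows "integrable L (\<lambda>x. \<Phi> x * w x)"
  using integrable_mult_bounded[OF assms(2) HellyD(6)[OF assms(1)] Helly_AE_abs_le[OF assms(1)]]
  by (simp add: mult.commute)

text \<open>
  The bound is uniform over the Helly space although the derivative of \<open>\<Phi>\<close> may be arbitrarily
  large: only its \<open>L\<^sup>1\<close> norm enters, and for a monotone map that is at most \<open>b - a\<close>. In the second
  formula the product \<open>m w'\<close> has to lie in \<open>W\<^sup>1\<^sup>,\<^sup>1\<close>, for otherwise its \<open>wderiv\<close> would be an
  arbitrary function and the integral might degenerate to \<open>0\<close>; the product rule ensures this.
\<close>

lemma f_ent_first_order_bound:
  assumes w: "w \<in> W21 a b"
  shows "\<exists>C\<ge>0. \<forall>\<alpha>\<ge>0. \<forall>\<Phi>\<in>Helly a b. \<bar>f_ent a b \<mu> \<alpha> w \<Phi> - (\<integral>x. \<Phi> x * w x \<partial>\<mu>)\<bar> \<le> \<alpha> * C"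
proof -
  let ?w' = "wderiv a b w"
  have w'W: "?w' \<in> W11 a b" by (rule wderiv_W21[OF ab w])
  have wW: "w \<in> W11 a b" using w W21_subset_W11 by auto
  have iw: "integrable L w" using has_weak_derivD(1)[OF has_weak_deriv_wderiv[OF wW]] .
  obtain Bw where Bw: "AE x in L. \<bar>w x\<bar> \<le> Bw" using W11_AE_bounded[OF ab wW] by blast
  obtain B where B: "B \<ge> 0" "AE x in L. \<bar>?w' x\<bar> \<le> B" using W11_AE_bounded[OF ab w'W] by blast
  have w'm: "?w' \<in> borel_measurable L"
    using has_weak_derivD(2)[OF has_weak_deriv_wderiv[OF wW]] by simp
  define k1 where "k1 = wderiv a b (\<lambda>y. m y * ?w' y)"
  define k2 where "k2 = wderiv a b m"
  have ik: "integrable L k1" "integrable L k2"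
    unfolding k1_def k2_def
    using has_weak_derivD(2)[OF has_weak_deriv_wderiv[OF W11_mult[OF ab W11_dens w'W]]]
      has_weak_derivD(2)[OF has_weak_deriv_wderiv[OF W11_dens]] by auto
  define C1 where "C1 = (B + 1) * dens_bound * (b - a)"
  define bt where "bt = (crep a b m b * crep a b ?w' b * b - crep a b m a * crep a b ?w' a * a)
    - (crep a b m b * b - crep a b m a * a)"
  define C2 where "C2 = (\<integral>x. abs_bound * \<bar>k2 x - k1 x\<bar> \<partial>L) + \<bar>bt\<bar>"
  have C1: "C1 \<ge> 0" unfolding C1_def using B(1) dens_bound(1) ab by auto
  have C2: "C2 \<ge> 0" unfolding C2_def abs_bound_def by (auto intro!: add_nonneg_nonneg Bochner_Integration.integral_nonneg)
  have "\<bar>f_ent a b \<mu> \<alpha> w \<Phi> - (\<integral>x. \<Phi> x * w x \<partial>\<mu>)\<bar> \<le> \<alpha> * (C1 + C2)"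
    if \<alpha>: "\<alpha> \<ge> 0" and \<Phi>: "\<Phi> \<in> Helly a b" for \<alpha> \<Phi>
  proof (cases "\<Phi> \<in> W11 a b \<and> continuous_on {a..b} \<Phi>")
    case True
    define g where "g = wderiv a b \<Phi>"
    have g: "has_weak_deriv a b \<Phi> g" unfolding g_def using True by (intro has_weak_deriv_wderiv) simp
    have ig: "integrable L g" using has_weak_derivD(2)[OF g] .
    have gw: "integrable L (\<lambda>x. g x * ?w' x)" by (rule integrable_mult_bounded[OF ig w'm B(2)])
    have g0: "AE x in L. 0 \<le> g x" and gint: "(\<integral>x. g x \<partial>L) \<le> b - a"
      using has_weak_deriv_mono[OF ab HellyD(1)[OF \<Phi>] g] HellyD(2,3)[OF \<Phi>] by auto
    note I = integrable_mu[OF integrable_Helly_mult[OF \<Phi> iw]] integrable_mu[OF gw] integrable_mu[OF ig]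
    have "f_ent a b \<mu> \<alpha> w \<Phi> = (\<integral>x. \<Phi> x * w x + \<alpha> * g x * ?w' x \<partial>\<mu>) - (\<integral>x. \<alpha> * g x \<partial>\<mu>)"
      unfolding f_ent_def g_def using True by simp
    also have "\<dots> = (\<integral>x. \<Phi> x * w x \<partial>\<mu>) + \<alpha> * ((\<integral>x. g x * ?w' x \<partial>\<mu>) - (\<integral>x. g x \<partial>\<mu>))"
      using I by (simp add: mult.assoc right_diff_distrib)
    finally have eq: "f_ent a b \<mu> \<alpha> w \<Phi> - (\<integral>x. \<Phi> x * w x \<partial>\<mu>)
      = \<alpha> * (\<integral>x. g x * ?w' x - g x \<partial>\<mu>)" using I by simp
    have "(\<integral>x. g x * ?w' x - g x \<partial>\<mu>) = (\<integral>x. m x * (g x * ?w' x - g x) \<partial>L)"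
      by (rule integral_mu) (use gw ig in measurable)
    then have "\<bar>\<integral>x. g x * ?w' x - g x \<partial>\<mu>\<bar> \<le> (\<integral>x. \<bar>m x * (g x * ?w' x - g x)\<bar> \<partial>L)"
      by (simp add: integral_abs_bound)
    also have "\<dots> \<le> (\<integral>x. (B + 1) * dens_bound * g x \<partial>L)"
    proof (rule integral_mono_AE)
      have "integrable L (\<lambda>x. (g x * ?w' x - g x) * m x)"
        by (rule integrable_mult_bounded[OF _ m_measurable m_AE_bound]) (use gw ig in simp)
      then show "integrable L (\<lambda>x. \<bar>m x * (g x * ?w' x - g x)\<bar>)" by (simp add: mult.commute)
      show "integrable L (\<lambda>x. (B + 1) * dens_bound * g x)" using ig by simp
      show "AE x in L. \<bar>m x * (g x * ?w' x - g x)\<bar> \<le> (B + 1) * dens_bound * g x"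
        using g0 B(2) m_AE_bound
      proof eventually_elim
        fix x assume x: "0 \<le> g x" "\<bar>?w' x\<bar> \<le> B" "\<bar>m x\<bar> \<le> dens_bound"
        have "\<bar>m x * (g x * ?w' x - g x)\<bar> = \<bar>m x\<bar> * (\<bar>?w' x - 1\<bar> * g x)"
        proof -
          have "g x * ?w' x - g x = (?w' x - 1) * g x" by (simp add: algebra_simps)
          then show ?thesis using x(1) by (simp add: abs_mult)
        qed
        also have "\<dots> \<le> dens_bound * ((B + 1) * g x)"
          using x dens_bound(1) B(1) by (intro mult_mono) auto
        finally show "\<bar>m x * (g x * ?w' x - g x)\<bar> \<le> (B + 1) * dens_bound * g x" by (simp add: mult_ac)
      qed
    qed
    also have "\<dots> = (B + 1) * dens_bound * (\<integral>x. g x \<partial>L)" by simp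
    also have "\<dots> \<le> C1" unfolding C1_def using gint B(1) dens_bound(1) by (intro mult_left_mono) auto
    finally have "\<bar>\<integral>x. g x * ?w' x - g x \<partial>\<mu>\<bar> \<le> C1 + C2" using C2 by simp
    then show ?thesis unfolding eq abs_mult using \<alpha> by (simp add: mult_left_mono)
  next
    case False
    have iwm: "integrable L (\<lambda>x. w x * m x)"
      by (rule integrable_mult_bounded[OF iw m_measurable m_AE_bound])
    have i3: "integrable L (\<lambda>x. \<Phi> x * (k2 x - k1 x))"
      using ik by (intro integrable_Helly_mult[OF \<Phi>]) simp
    have "f_ent a b \<mu> \<alpha> w \<Phi> = (\<integral>x. \<Phi> x * (w x * m x - \<alpha> * k1 x + \<alpha> * k2 x) \<partial>L) + \<alpha> * bt"
      unfolding f_ent_def Let_def k1_def k2_def bt_def if_not_P[OF False]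
      using HellyD(2,3)[OF \<Phi>] by (simp add: algebra_simps)
    also have "(\<integral>x. \<Phi> x * (w x * m x - \<alpha> * k1 x + \<alpha> * k2 x) \<partial>L)
        = (\<integral>x. \<Phi> x * (w x * m x) + \<alpha> * (\<Phi> x * (k2 x - k1 x)) \<partial>L)"
      by (intro Bochner_Integration.integral_cong) (auto simp: algebra_simps)
    also have "\<dots> = (\<integral>x. \<Phi> x * (w x * m x) \<partial>L) + \<alpha> * (\<integral>x. \<Phi> x * (k2 x - k1 x) \<partial>L)"
      using integrable_Helly_mult[OF \<Phi> iwm] i3 by simp
    also have "(\<integral>x. \<Phi> x * (w x * m x) \<partial>L) = (\<integral>x. \<Phi> x * w x \<partial>\<mu>)"
      using integral_mu[OF borel_measurable_integrable[OF integrable_Helly_mult[OF \<Phi> iw]]]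
      by (simp add: mult_ac)
    finally have eq: "f_ent a b \<mu> \<alpha> w \<Phi> - (\<integral>x. \<Phi> x * w x \<partial>\<mu>) = \<alpha> * ((\<integral>x. \<Phi> x * (k2 x - k1 x) \<partial>L) + bt)"
      by (simp add: algebra_simps)
    have "\<bar>\<integral>x. \<Phi> x * (k2 x - k1 x) \<partial>L\<bar> \<le> (\<integral>x. \<bar>\<Phi> x * (k2 x - k1 x)\<bar> \<partial>L)"
      by (rule integral_abs_bound)
    also have "\<dots> \<le> (\<integral>x. abs_bound * \<bar>k2 x - k1 x\<bar> \<partial>L)"
    proof (rule integral_mono)
      show "integrable L (\<lambda>x. \<bar>\<Phi> x * (k2 x - k1 x)\<bar>)" using i3 by (rule integrable_abs)
      show "integrable L (\<lambda>x. abs_bound * \<bar>k2 x - k1 x\<bar>)" using ik by simp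
    qed (auto simp: abs_mult intro!: mult_right_mono Helly_abs_le[OF \<Phi>])
    finally have "\<bar>(\<integral>x. \<Phi> x * (k2 x - k1 x) \<partial>L) + bt\<bar> \<le> C1 + C2"
      using C1 unfolding C2_def by linarith
    then show ?thesis unfolding eq abs_mult using \<alpha> by (simp add: mult_left_mono)
  qed
  then show ?thesis using C1 C2 by (intro exI[of _ "C1 + C2"]) auto
qed

text \<open>
  The preimage of an interval of length \<open>len\<close> under a map of slope at least \<open>\<epsilon>\<close> is an interval of
  length at most \<open>len / \<epsilon>\<close>. By the comparison principle the pushforward of \<open>\<mu>\<close> is
  at most \<open>dens_bound / \<epsilon>\<close> times Lebesgue measure.
\<close>

lemma Ent_pushforward_less_infinity:
  assumes \<Psi>: "\<Psi> \<in> Helly a b" and e: "\<epsilon> > 0"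
    and exp: "\<And>x y. a \<le> x \<Longrightarrow> x \<le> y \<Longrightarrow> y \<le> b \<Longrightarrow> \<epsilon> * (y - x) \<le> \<Psi> y - \<Psi> x"
  shows "Ent a b (distr \<mu> L \<Psi>) < \<infinity>"
proof (rule Ent_less_infinity)
  show "sets (distr \<mu> L \<Psi>) = sets L" by simp
  have \<Psi>m: "\<Psi> \<in> measurable \<mu> L" "\<Psi> \<in> measurable \<mu> borel" using HellyD(6,7)[OF \<Psi>] by (simp_all add: measurable_mu)
  define K where "K = dens_bound / \<epsilon>"
  have K: "K > 0" using dens_bound e by (simp add: K_def)
  define N where "N = distr \<mu> borel \<Psi>"
  define Q where "Q = density lborel (\<lambda>x. ennreal K * indicator {a..b} x)"
  have Q: "emeasure Q A = ennreal K * emeasure lborel (A \<inter> {a..b})" if "A \<in> sets borel" for A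
  proof -
    have "emeasure Q A = (\<integral>\<^sup>+x. ennreal K * indicator (A \<inter> {a..b}) x \<partial>lborel)"
      unfolding Q_def using that by (subst emeasure_density) (auto intro!: nn_integral_cong simp: indicator_def)
    then show ?thesis using that by (simp add: nn_integral_cmult_indicator)
  qed
  have int: "emeasure N {l<..<u} \<le> emeasure Q {l<..<u}" for l u
  proof -
    define J where "J = \<Psi> -` {l<..<u} \<inter> {a..b}"
    have J: "J \<in> sets L" unfolding J_def using measurable_sets[OF HellyD(6)[OF \<Psi>], of "{l<..<u}"] by simp
    have eN: "emeasure N {l<..<u} = emeasure \<mu> J" unfolding N_def J_def using \<Psi>m by (subst emeasure_distr) auto
    show ?thesis
    proof (cases "J = {}")
      case False
      define len where "len = min u b - max l a"
      have in_: "max l a \<le> \<Psi> x" "\<Psi> x \<le> min u b" if "x \<in> J" for x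
        using that HellyD(4,5)[OF \<Psi>, of x] by (auto simp: J_def)
      have len0: "len \<ge> 0" using False in_ by (force simp: len_def)
      have dist: "y \<le> x + len / \<epsilon>" if "x \<in> J" "y \<in> J" for x y
      proof (cases "x \<le> y")
        case True
        have "\<epsilon> * (y - x) \<le> len" using exp[of x y] True that in_[of x] in_[of y] by (auto simp: len_def J_def)
        then show ?thesis using e by (simp add: field_simps)
      next
        case False
        have "0 \<le> len / \<epsilon>" using len0 e by simp
        then show ?thesis using False by linarith
      qed
      have bdd: "bdd_below J" "bdd_above J"
        unfolding J_def by (auto simp: bdd_below_def bdd_above_def)
      have "Sup J \<le> x + len / \<epsilon>" if "x \<in> J" for x
        using False dist that by (intro cSup_least) auto
      then have "Sup J - len / \<epsilon> \<le> Inf J" using False by (intro cInf_greatest) (auto simp: algebra_simps)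
      moreover have "J \<subseteq> {Inf J..Sup J}" using bdd by (auto intro: cInf_lower cSup_upper)
      moreover have "Inf J \<le> Sup J" using cInf_le_cSup[OF False bdd(2,1)] .
      ultimately have "emeasure lborel J \<le> ennreal (len / \<epsilon>)"
        by (intro order_trans[OF emeasure_mono[of J "{Inf J..Sup J}"]]) (auto intro: ennreal_leI)
      moreover have "emeasure L J = emeasure lborel J" by (rule emeasure_leb_on) (auto simp: J_def)
      ultimately have "emeasure \<mu> J \<le> ennreal dens_bound * ennreal (len / \<epsilon>)"
        using emeasure_mu_le[OF J] by (metis dual_order.trans mult_left_mono zero_le)
      also have "\<dots> = ennreal K * ennreal len"
        using dens_bound(1) e len0 by (simp add: K_def flip: ennreal_mult)
      also have "\<dots> \<le> ennreal K * emeasure lborel ({l<..<u} \<inter> {a..b})"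
      proof (rule mult_left_mono)
        have "ennreal len = emeasure lborel {max l a<..<min u b}"
          using len0 by (simp add: len_def)
        also have "\<dots> \<le> emeasure lborel ({l<..<u} \<inter> {a..b})"
          by (rule emeasure_mono) auto
        finally show "ennreal len \<le> emeasure lborel ({l<..<u} \<inter> {a..b})" .
      qed simp
      finally show ?thesis unfolding eN by (subst Q) auto
    qed (simp add: eN)
  qed
  have "emeasure Q (space Q) \<noteq> \<infinity>"
    using Q[of UNIV] by (simp add: Q_def[symmetric] emeasure_lborel_Icc_eq ennreal_mult_eq_top_iff) (simp add: Q_def emeasure_lborel_Icc_eq ennreal_mult_eq_top_iff)
  note le = emeasure_le_if_le_on_open_intervals[OF _ _ this int]
  fix A assume A: "A \<in> sets L"
  then have Ab: "A \<in> sets borel" "A \<subseteq> {a..b}"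
    by (auto simp: sets_leb_on sets_restrict_space_iff)
  have "emeasure (distr \<mu> L \<Psi>) A = emeasure N A"
    unfolding N_def using \<Psi>m A Ab by (simp add: emeasure_distr)
  also have "\<dots> \<le> emeasure Q A" by (rule le) (auto simp: N_def Q_def Ab)
  also have "\<dots> = ennreal K * emeasure L A"
    using Ab by (simp add: Q emeasure_leb_on Int_absorb2)
  finally show "emeasure (distr \<mu> L \<Psi>) A \<le> ennreal K * emeasure L A" .
qed
end

section \<open>The limit problem\<close>

lemma less_square_if_abs_less: "\<bar>p\<bar> < \<bar>q\<bar> \<Longrightarrow> p\<^sup>2 < (q\<^sup>2 :: real)"
  by (metis abs_le_square_iff not_le)

locale quadratic_problem = bounded_density +
  fixes t :: real and u0 :: "real \<Rightarrow> real"
  assumes t: "0 \<le> t" and u0: "u0 \<in> W21 a b"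
begin

abbreviation "F0 \<equiv> F_zero \<mu> t u0"

lemma u0_integrable: "integrable L u0"
  using u0 by (auto simp: W21_def dest: has_weak_derivD(1))

text \<open>As a function of \<open>p\<close> this is \<open>(p - (x + t u0(x)))\<^sup>2 / 2\<close> up to a term that does not depend on \<open>p\<close>.\<close>

definition integrand0 :: "real \<Rightarrow> real \<Rightarrow> real" where
  "integrand0 x p = (p - x)\<^sup>2 / 2 - t * (p * u0 x)"

lemma integrable_bounded_L:
  fixes f :: "real \<Rightarrow> real"
  assumes "f \<in> borel_measurable L" "\<And>x. x \<in> {a..b} \<Longrightarrow> \<bar>f x\<bar> \<le> B"
  shows "integrable L f"
  using assms by (intro L.integrable_const_bound[where B=B]) (auto simp: AE_restrict_space_iff)

lemma Helly_diff_sq_le: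
  assumes "\<Phi> \<in> Helly a b" "x \<in> {a..b}" "y \<in> {a..b}"
  shows "(\<Phi> x - y)\<^sup>2 \<le> (b - a)\<^sup>2"
  using HellyD(4,5)[OF assms(1,2)] assms(3) by (intro abs_le_square_iff[THEN iffD1]) auto

lemma integrable_square:
  assumes \<Phi>: "\<Phi> \<in> Helly a b"
  shows "integrable L (\<lambda>x. (\<Phi> x - x)\<^sup>2 / 2)"
proof (rule integrable_bounded_L)
  show "(\<lambda>x. (\<Phi> x - x)\<^sup>2 / 2) \<in> borel_measurable L"
    using HellyD(6)[OF \<Phi>] id_measurable_leb_on[of a b] by measurable
  show "\<bar>(\<Phi> x - x)\<^sup>2 / 2\<bar> \<le> (b - a)\<^sup>2" if "x \<in> {a..b}" for x
    using Helly_diff_sq_le[OF \<Phi> that that] by (rule order_trans[rotated]) simp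
qed

lemma integrable_integrand0:
  assumes \<Phi>: "\<Phi> \<in> Helly a b"
  shows "integrable \<mu> (\<lambda>x. integrand0 x (\<Phi> x))"
  unfolding integrand0_def
  using integrable_square[OF \<Phi>] integrable_Helly_mult[OF \<Phi> u0_integrable] by (intro integrable_mu) simp

lemma F0_eq:
  assumes \<Phi>: "\<Phi> \<in> Helly a b"
  shows "F0 \<Phi> = (\<integral>x. integrand0 x (\<Phi> x) \<partial>\<mu>)"
  unfolding F_zero_def integrand0_def
  using integrable_mu[OF integrable_square[OF \<Phi>]] integrable_mu[OF integrable_Helly_mult[OF \<Phi> u0_integrable]]
  by simp

lemma Helly_convex:
  assumes "\<Phi> \<in> Helly a b" "\<Psi> \<in> Helly a b" "0 \<le> s" "s \<le> 1"
  shows "(\<lambda>x\<in>{a..b}. (1 - s) * \<Phi> x + s * \<Psi> x) \<in> Helly a b"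
proof (rule HellyI)
  show "mono_on {a..b} (\<lambda>x. (1 - s) * \<Phi> x + s * \<Psi> x)"
    using HellyD(1)[OF assms(1)] HellyD(1)[OF assms(2)] assms(3,4)
    by (auto simp: mono_on_def intro!: add_mono mult_left_mono)
qed (use HellyD(2,3)[OF assms(1)] HellyD(2,3)[OF assms(2)] ab in \<open>auto simp: algebra_simps\<close>)

lemma Helly_id: "(\<lambda>x\<in>{a..b}. x) \<in> Helly a b"
  by (rule HellyI) (use ab in \<open>auto simp: mono_on_def\<close>)

lemma integrable_diff_square:
  assumes "\<Phi> \<in> Helly a b" "\<Psi> \<in> Helly a b"
  shows "integrable \<mu> (\<lambda>x. (\<Phi> x - \<Psi> x)\<^sup>2)"
proof (intro integrable_mu integrable_bounded_L)
  show "(\<lambda>x. (\<Phi> x - \<Psi> x)\<^sup>2) \<in> borel_measurable L"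
    using HellyD(6)[OF assms(1)] HellyD(6)[OF assms(2)] by measurable
  show "\<bar>(\<Phi> x - \<Psi> x)\<^sup>2\<bar> \<le> (b - a)\<^sup>2" if "x \<in> {a..b}" for x
    using Helly_diff_sq_le[OF assms(1) that, of "\<Psi> x"] HellyD(4,5)[OF assms(2) that] by simp
qed

text \<open>
  The integrand is a quadratic polynomial in \<open>p\<close> with leading coefficient \<open>1/2\<close>, so its deficit from
  affinity along a segment is exact. Weight \<open>1/2\<close> is the parallelogram identity; small weights are
  used for moving towards the identity map.
\<close>

lemma F0_convex_combination:
  assumes \<Phi>: "\<Phi> \<in> Helly a b" and \<Psi>: "\<Psi> \<in> Helly a b" and s: "0 \<le> s" "s \<le> 1"
  shows "F0 (\<lambda>x\<in>{a..b}. (1 - s) * \<Phi> x + s * \<Psi> x)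
    = (1 - s) * F0 \<Phi> + s * F0 \<Psi> - s * (1 - s) / 2 * (\<integral>x. (\<Phi> x - \<Psi> x)\<^sup>2 \<partial>\<mu>)"
proof -
  have "F0 (\<lambda>x\<in>{a..b}. (1 - s) * \<Phi> x + s * \<Psi> x)
     = (\<integral>x. integrand0 x ((\<lambda>x\<in>{a..b}. (1 - s) * \<Phi> x + s * \<Psi> x) x) \<partial>\<mu>)"
    by (rule F0_eq[OF Helly_convex[OF assms]])
  also have "\<dots> = (\<integral>x. (1 - s) * integrand0 x (\<Phi> x) + s * integrand0 x (\<Psi> x) - s * (1 - s) / 2 * (\<Phi> x - \<Psi> x)\<^sup>2 \<partial>\<mu>)"
    by (intro Bochner_Integration.integral_cong)
       (auto simp: integrand0_def power2_eq_square field_simps)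
  also have "\<dots> = (1 - s) * F0 \<Phi> + s * F0 \<Psi> - s * (1 - s) / 2 * (\<integral>x. (\<Phi> x - \<Psi> x)\<^sup>2 \<partial>\<mu>)"
    using integrable_integrand0[OF \<Phi>] integrable_integrand0[OF \<Psi>] integrable_diff_square[OF \<Phi> \<Psi>]
    by (simp add: F0_eq[OF \<Phi>] F0_eq[OF \<Psi>])
  finally show ?thesis .
qed

lemma L2_distance_le_excess:
  assumes \<Phi>: "\<Phi> \<in> Helly a b" and \<Psi>: "\<Psi> \<in> Helly a b"
    and lb: "\<And>\<Theta>. \<Theta> \<in> Helly a b \<Longrightarrow> I \<le> F0 \<Theta>"
  shows "(\<integral>x. (\<Phi> x - \<Psi> x)\<^sup>2 \<partial>\<mu>) \<le> 4 * ((F0 \<Phi> - I) + (F0 \<Psi> - I))"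
  using lb[OF Helly_convex[OF \<Phi> \<Psi>, of "1/2"]] F0_convex_combination[OF \<Phi> \<Psi>, of "1/2"]
  by simp

definition dominator :: "real \<Rightarrow> real" where
  "dominator x = (b - a)\<^sup>2 + t * (abs_bound * \<bar>u0 x\<bar>)"

lemma abs_integrand0_le:
  assumes \<Phi>: "\<Phi> \<in> Helly a b" and x: "x \<in> {a..b}"
  shows "\<bar>integrand0 x (\<Phi> x)\<bar> \<le> dominator x"
proof -
  have "\<bar>\<Phi> x\<bar> * \<bar>u0 x\<bar> \<le> abs_bound * \<bar>u0 x\<bar>" by (intro mult_right_mono Helly_abs_le[OF \<Phi> x]) simp
  then have "\<bar>t * (\<Phi> x * u0 x)\<bar> \<le> t * (abs_bound * \<bar>u0 x\<bar>)"
    using t by (simp add: abs_mult mult_left_mono)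
  moreover have "\<bar>(\<Phi> x - x)\<^sup>2 / 2\<bar> \<le> (b - a)\<^sup>2" 
    using Helly_diff_sq_le[OF \<Phi> x x] by (rule order_trans[rotated]) simp
  ultimately show ?thesis unfolding integrand0_def dominator_def by linarith
qed

lemma integrable_dominator: "integrable \<mu> dominator"
  unfolding dominator_def using u0_integrable by (intro integrable_mu) simp

lemma F0_bounded_below:
  assumes \<Phi>: "\<Phi> \<in> Helly a b"
  shows "- (\<integral>x. dominator x \<partial>\<mu>) \<le> F0 \<Phi>"
proof -
  have "\<bar>F0 \<Phi>\<bar> \<le> (\<integral>x. \<bar>integrand0 x (\<Phi> x)\<bar> \<partial>\<mu>)" unfolding F0_eq[OF \<Phi>] by (rule integral_abs_bound)
  also have "\<dots> \<le> (\<integral>x. dominator x \<partial>\<mu>)"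
    using integrable_integrand0[OF \<Phi>] integrable_dominator abs_integrand0_le[OF \<Phi>] by (intro integral_mono) auto
  finally show ?thesis by linarith
qed

text \<open>
  A minimizing sequence is Cauchy in \<open>L\<^sup>1(\<mu>)\<close>, so a subsequence converges almost everywhere. Its
  pointwise limit superior is defined on all of \<open>[a, b]\<close> and inherits monotonicity and the endpoint
  values, and \<open>F\<^sub>0\<close> passes to the limit by dominated convergence.
\<close>

lemma minimizer_exists: "\<exists>\<Phi>\<in>Helly a b. \<forall>\<Psi>\<in>Helly a b. F0 \<Phi> \<le> F0 \<Psi>"
proof -
  define I where "I = Inf (F0 ` Helly a b)"
  have bdd: "bdd_below (F0 ` Helly a b)" using F0_bounded_below by (auto simp: bdd_below_def)
  have lb: "I \<le> F0 \<Theta>" if "\<Theta> \<in> Helly a b" for \<Theta>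
    unfolding I_def using that bdd by (intro cInf_lower) auto
  have "\<exists>\<Psi>\<in>Helly a b. F0 \<Psi> < I + 1 / real (Suc n)" for n
  proof -
    have "I < I + 1 / real (Suc n)" by simp
    then show ?thesis unfolding I_def using bdd Helly_id by (subst (asm) cInf_less_iff) auto
  qed
  then obtain \<Psi> where \<Psi>: "\<And>n. \<Psi> n \<in> Helly a b" "\<And>n. F0 (\<Psi> n) < I + 1 / real (Suc n)" by metis
  have i\<Psi>: "integrable \<mu> (\<Psi> n)" for n
    using integrable_mu[OF integrable_Helly_mult[OF \<Psi>(1), of "\<lambda>_. 1" n]] by simp
  have cauchy: "\<exists>N. \<forall>i\<ge>N. \<forall>j\<ge>N. (\<integral>x. norm (\<Psi> i x - \<Psi> j x) \<partial>\<mu>) < e" if e: "e > 0" for e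
  proof -
    define d where "d = e / 4"
    have d: "d > 0" using e by (simp add: d_def)
    obtain N :: nat where N: "8 / d\<^sup>2 < real N" using reals_Archimedean2 by blast
    have "(\<integral>x. norm (\<Psi> i x - \<Psi> j x) \<partial>\<mu>) < e" if ij: "i \<ge> N" "j \<ge> N" for i j
    proof -
      let ?S = "\<integral>x. (\<Psi> i x - \<Psi> j x)\<^sup>2 \<partial>\<mu>"
      have inv: "1 / real (Suc n) < d\<^sup>2 / 8" if "n \<ge> N" for n
      proof -
        have "8 / d\<^sup>2 < real (Suc n)" using N that by simp
        then show ?thesis using d by (simp add: field_simps)
      qed
      have "?S \<le> 4 * ((F0 (\<Psi> i) - I) + (F0 (\<Psi> j) - I))" by (rule L2_distance_le_excess[OF \<Psi>(1) \<Psi>(1) lb])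
      moreover have "F0 (\<Psi> i) - I < d\<^sup>2 / 8" "F0 (\<Psi> j) - I < d\<^sup>2 / 8"
        using less_trans[OF \<Psi>(2)[of i] add_strict_left_mono[OF inv[OF ij(1)]]]
          less_trans[OF \<Psi>(2)[of j] add_strict_left_mono[OF inv[OF ij(2)]]] by simp_all
      ultimately have S: "?S < d\<^sup>2" by simp
      \<comment> \<open>an elementary substitute for the Cauchy-Schwarz inequality, passing from \<open>L\<^sup>2\<close> to \<open>L\<^sup>1\<close>\<close>
      have pw: "\<bar>z\<bar> \<le> d + z\<^sup>2 / d" for z
      proof (cases "\<bar>z\<bar> \<le> d")
        case True
        moreover have "0 \<le> z\<^sup>2 / d" using d by simp
        ultimately show ?thesis by linarith
      next
        case False
        then have "\<bar>z\<bar> * d \<le> \<bar>z\<bar> * \<bar>z\<bar>" by (intro mult_left_mono) auto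
        then have "\<bar>z\<bar> \<le> z\<^sup>2 / d" using d by (simp add: field_simps power2_eq_square)
        then show ?thesis using d by simp
      qed
      have "(\<integral>x. norm (\<Psi> i x - \<Psi> j x) \<partial>\<mu>) \<le> (\<integral>x. d + (\<Psi> i x - \<Psi> j x)\<^sup>2 / d \<partial>\<mu>)"
        using i\<Psi> integrable_diff_square[OF \<Psi>(1)[of i] \<Psi>(1)[of j]] pw by (intro integral_mono) auto
      also have "\<dots> = d + ?S / d" using integrable_diff_square[OF \<Psi>(1)[of i] \<Psi>(1)[of j]] P.prob_space by simp
      also have "\<dots> \<le> d + d" using S d by (simp add: field_simps power2_eq_square)
      also have "\<dots> < e" using e by (simp add: d_def)
      finally show ?thesis .
    qed
    then show ?thesis by blast
  qed
  obtain r where r: "strict_mono r" "AE x in \<mu>. Cauchy (\<lambda>i. \<Psi> (r i) x)"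
    by (rule cauchy_L1_AE_cauchy_subseq[OF i\<Psi> cauchy]) auto
  define S where "S = (\<lambda>x. limsup (\<lambda>n. ereal (\<Psi> (r n) x)))"
  have Sb: "ereal a \<le> S x" "S x \<le> ereal b" if "x \<in> {a..b}" for x
    unfolding S_def using HellyD(4,5)[OF \<Psi>(1) that]
    by (auto intro!: le_Limsup Limsup_bounded always_eventually)
  have Slim: "S x = ereal l" if "(\<lambda>n. \<Psi> (r n) x) \<longlonglongrightarrow> l" for x l
    unfolding S_def using that by (intro lim_imp_Limsup) auto
  have Smono: "S x \<le> S y" if "x \<in> {a..b}" "y \<in> {a..b}" "x \<le> y" for x y
    unfolding S_def using mono_onD[OF HellyD(1)[OF \<Psi>(1)]] that
    by (intro Limsup_mono always_eventually allI) auto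
  have fin: "\<bar>S x\<bar> \<noteq> \<infinity>" if "x \<in> {a..b}" for x using Sb[OF that] by auto
  define \<Phi> where "\<Phi> = (\<lambda>x\<in>{a..b}. real_of_ereal (S x))"
  have \<Phi>: "\<Phi> \<in> Helly a b"
    unfolding \<Phi>_def
  proof (rule HellyI)
    show "mono_on {a..b} (\<lambda>x. real_of_ereal (S x))"
    proof (rule mono_onI)
      fix x y assume "x \<in> {a..b}" "y \<in> {a..b}" "x \<le> y"
      then show "real_of_ereal (S x) \<le> real_of_ereal (S y)"
        using Smono[of x y] fin[of x] fin[of y] by (cases "S x"; cases "S y") auto
    qed
    show "real_of_ereal (S a) = a" "real_of_ereal (S b) = b"
      using Slim[of a a] Slim[of b b] HellyD(2,3)[OF \<Psi>(1)] by auto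
  qed (use ab in simp)
  have conv: "AE x in \<mu>. (\<lambda>n. \<Psi> (r n) x) \<longlonglongrightarrow> \<Phi> x"
    using r(2) AE_space[of \<mu>]
  proof eventually_elim
    fix x assume x: "Cauchy (\<lambda>i. \<Psi> (r i) x)" "x \<in> space \<mu>"
    then obtain l where l: "(\<lambda>n. \<Psi> (r n) x) \<longlonglongrightarrow> l" by (auto simp: Cauchy_convergent_iff convergent_def)
    then show "(\<lambda>n. \<Psi> (r n) x) \<longlonglongrightarrow> \<Phi> x" using Slim[OF l] x(2) by (simp add: \<Phi>_def)
  qed
  have "(\<lambda>n. F0 (\<Psi> (r n))) \<longlonglongrightarrow> F0 \<Phi>"
    unfolding F0_eq[OF \<Phi>] F0_eq[OF \<Psi>(1)]
  proof (rule integral_dominated_convergence[OF _ _ integrable_dominator])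
    show "AE x in \<mu>. (\<lambda>i. integrand0 x (\<Psi> (r i) x)) \<longlonglongrightarrow> integrand0 x (\<Phi> x)"
      using conv by eventually_elim (auto simp: integrand0_def intro!: tendsto_intros)
    show "AE x in \<mu>. norm (integrand0 x (\<Psi> (r i) x)) \<le> dominator x" for i
      using AE_space[of \<mu>] by eventually_elim (use abs_integrand0_le[OF \<Psi>(1)] in auto)
  qed (use integrable_integrand0[OF \<Phi>] integrable_integrand0[OF \<Psi>(1)] in auto)
  moreover have "(\<lambda>n. F0 (\<Psi> (r n))) \<longlonglongrightarrow> I"
  proof (rule tendsto_sandwich[of "\<lambda>_. I" _ _ "\<lambda>n. I + 1 / real (Suc (r n))"])
    have "(\<lambda>n. 1 / real (Suc n)) \<longlonglongrightarrow> 0" using LIMSEQ_inverse_real_of_nat by (simp add: inverse_eq_divide)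
    then have "(\<lambda>n. 1 / real (Suc (r n))) \<longlonglongrightarrow> 0"
      using LIMSEQ_subseq_LIMSEQ[OF _ r(1)] by (auto simp: o_def)
    then show "(\<lambda>n. I + 1 / real (Suc (r n))) \<longlonglongrightarrow> I"
      using tendsto_add[OF tendsto_const[of I]] by fastforce
    show "\<forall>\<^sub>F n in sequentially. I \<le> F0 (\<Psi> (r n))" using lb \<Psi>(1) by simp
    show "\<forall>\<^sub>F n in sequentially. F0 (\<Psi> (r n)) \<le> I + 1 / real (Suc (r n))"
      using less_imp_le[OF \<Psi>(2)] by (intro always_eventually) blast
  qed simp
  ultimately have "F0 \<Phi> = I" by (rule LIMSEQ_unique)
  then show ?thesis using \<Phi> lb by auto
qed

text \<open>
  The conditions on either side keep the modified map monotone; the strict inequality on \<open>[y, z]\<close>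
  makes it strictly better because \<open>\<mu>\<close> charges that interval.
\<close>

lemma strict_improvement:
  assumes \<Phi>: "\<Phi> \<in> Helly a b" and yz: "a < y" "y < z" "z < b"
    and left: "\<And>x. x \<in> {a..<y} \<Longrightarrow> \<Phi> x \<le> c" and right: "\<And>x. x \<in> {z<..b} \<Longrightarrow> c \<le> \<Phi> x"
    and better: "AE x in L. x \<in> {y..z} \<longrightarrow> (c - (x + t * u0 x))\<^sup>2 < (\<Phi> x - (x + t * u0 x))\<^sup>2"
  shows "\<exists>\<Psi>\<in>Helly a b. F0 \<Psi> < F0 \<Phi>"
proof -
  define \<Psi> where "\<Psi> = (\<lambda>x\<in>{a..b}. if x \<in> {y..z} then c else \<Phi> x)"
  have \<Psi>: "\<Psi> \<in> Helly a b"
    unfolding \<Psi>_def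
  proof (rule HellyI)
    show "mono_on {a..b} (\<lambda>x. if x \<in> {y..z} then c else \<Phi> x)"
      using left right mono_onD[OF HellyD(1)[OF \<Phi>]] by (intro mono_onI) auto
  qed (use yz HellyD(2,3)[OF \<Phi>] in auto)
  let ?d = "\<lambda>x. integrand0 x (\<Phi> x) - integrand0 x (\<Psi> x)"
  have id: "integrable \<mu> ?d" using integrable_integrand0[OF \<Phi>] integrable_integrand0[OF \<Psi>] by simp
  have eq: "F0 \<Phi> - F0 \<Psi> = (\<integral>x. ?d x \<partial>\<mu>)"
    unfolding F0_eq[OF \<Phi>] F0_eq[OF \<Psi>] using integrable_integrand0[OF \<Phi>] integrable_integrand0[OF \<Psi>] by simp
  have e: "integrand0 x p - integrand0 x q = ((p - (x + t * u0 x))\<^sup>2 - (q - (x + t * u0 x))\<^sup>2) / 2" for x p q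
    by (simp add: integrand0_def power2_eq_square field_simps)
  have pos: "AE x in \<mu>. 0 \<le> ?d x \<and> (x \<in> {y..z} \<longrightarrow> 0 < ?d x)"
    using AE_mu[OF better] AE_space[of \<mu>]
  proof eventually_elim
    fix x assume x: "x \<in> {y..z} \<longrightarrow> (c - (x + t * u0 x))\<^sup>2 < (\<Phi> x - (x + t * u0 x))\<^sup>2" "x \<in> space \<mu>"
    then show "0 \<le> ?d x \<and> (x \<in> {y..z} \<longrightarrow> 0 < ?d x)"
      unfolding e by (auto simp: \<Psi>_def)
  qed
  have nn: "AE x in \<mu>. 0 \<le> ?d x" using pos by eventually_elim simp
  have "(\<integral>x. ?d x \<partial>\<mu>) \<noteq> 0"
  proof
    assume "(\<integral>x. ?d x \<partial>\<mu>) = 0"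
    then have "AE x in \<mu>. ?d x = 0" using integral_nonneg_eq_0_iff_AE[OF id nn] by simp
    then have "AE x in \<mu>. x \<notin> {y..z}" using pos by eventually_elim auto
    moreover have "{y..z} \<in> sets \<mu>" using yz by (subst sets_mu, subst sets_restrict_space_iff) auto
    ultimately have "measure \<mu> {y..z} = 0"
      by (subst (asm) AE_iff_measurable[of "{y..z}"]) (use yz in \<open>auto simp: measure_def\<close>)
    then show False using measure_mu_interval_pos[of y z] yz by simp
  qed
  moreover have "0 \<le> (\<integral>x. ?d x \<partial>\<mu>)" by (rule integral_nonneg_AE[OF nn])
  ultimately have "F0 \<Psi> < F0 \<Phi>" using eq by linarith
  then show ?thesis using \<Psi> by blast
qed

text \<open>
  Suppose that \<open>\<Phi> \<le> p\<close> to the left of \<open>x\<^sub>0\<close> and \<open>\<Phi> \<ge> p + e\<close> to the right, and let \<open>G\<close> be the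
  continuous representative of \<open>x + t u0(x)\<close>. If \<open>G(x\<^sub>0) > p + e/2\<close>, the constant \<open>p + e/2\<close> lies
  strictly between \<open>\<Phi>\<close> and \<open>G\<close> on a short interval to the left of \<open>x\<^sub>0\<close>, so it is closer to
  \<open>G\<close>. Otherwise \<open>G(x\<^sub>0) < p + 3e/4\<close>, and the constant \<open>p + 3e/4\<close> is closer to \<open>G\<close> to the right of
  \<open>x\<^sub>0\<close>.
\<close>

lemma minimizer_has_no_jump:
  assumes \<Phi>: "\<Phi> \<in> Helly a b" and min: "\<And>\<Psi>. \<Psi> \<in> Helly a b \<Longrightarrow> F0 \<Phi> \<le> F0 \<Psi>"
    and x0: "a < x0" "x0 < b" and e: "e > 0"
  shows "\<exists>y z. a < y \<and> y < x0 \<and> x0 < z \<and> z < b \<and> \<Phi> z - \<Phi> y < e"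
proof (rule ccontr)
  assume "\<not> ?thesis"
  then have gap: "\<Phi> y + e \<le> \<Phi> z" if "a < y" "y < x0" "x0 < z" "z < b" for y z using that by force
  obtain v where v: "continuous_on UNIV v" "AE x in L. u0 x = v x"
    using W11_continuous_representative[OF ab] u0 W21_subset_W11 by blast
  define G where "G = (\<lambda>x. x + t * v x)"
  have G: "isCont G x0"
    using v(1) unfolding G_def by (intro continuous_intros) (simp add: continuous_on_eq_continuous_at)
  define p where "p = Sup (\<Phi> ` {a<..<x0})"
  have bdd: "bdd_above (\<Phi> ` {a<..<x0})"
    using HellyD(5)[OF \<Phi>] x0 by (intro bdd_aboveI2[where M=b]) auto
  have p: "\<Phi> y \<le> p" if "y \<in> {a..<x0}" for y
  proof -
    have "\<Phi> y \<le> \<Phi> ((y + x0) / 2)" using mono_onD[OF HellyD(1)[OF \<Phi>], of y "(y + x0) / 2"] that x0 by auto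
    also have "\<dots> \<le> p" unfolding p_def using that x0 by (intro cSup_upper bdd) auto
    finally show ?thesis .
  qed
  have q: "p + e \<le> \<Phi> z" if "z \<in> {x0<..b}" for z
  proof -
    have "p \<le> \<Phi> ((z + x0) / 2) - e"
      unfolding p_def
    proof (rule cSup_least)
      show "\<Phi> ` {a<..<x0} \<noteq> {}" using x0 by auto
      fix w assume "w \<in> \<Phi> ` {a<..<x0}"
      then obtain y where y: "w = \<Phi> y" "y \<in> {a<..<x0}" by auto
      then show "w \<le> \<Phi> ((z + x0) / 2) - e" using gap[of y "(z + x0) / 2"] that by auto
    qed
    moreover have "\<Phi> ((z + x0) / 2) \<le> \<Phi> z" using mono_onD[OF HellyD(1)[OF \<Phi>], of "(z + x0) / 2" z] that x0 by auto
    ultimately show ?thesis by simp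
  qed
  have "\<exists>\<Psi>\<in>Helly a b. F0 \<Psi> < F0 \<Phi>"
  proof (cases "p + e / 2 < G x0")
    case True
    have "\<forall>\<^sub>F x in at x0. p + e / 2 < G x" using order_tendstoD(1)[OF G[unfolded isCont_def] True] .
    then obtain d where d: "d > 0" "\<And>x. x \<noteq> x0 \<Longrightarrow> dist x x0 < d \<Longrightarrow> p + e / 2 < G x"
      unfolding eventually_at by blast
    define y where "y = max ((a + x0) / 2) (x0 - d / 2)"
    have y: "a < y" "y < x0" "x0 - d < y" using x0 d by (auto simp: y_def less_max_iff_disj)
    show ?thesis
    proof (rule strict_improvement[OF \<Phi>, of y x0 "p + e / 2"])
      show "\<Phi> x \<le> p + e / 2" if "x \<in> {a..<y}" for x using p[of x] that y e by auto
      show "p + e / 2 \<le> \<Phi> x" if "x \<in> {x0<..b}" for x using q[of x] that e by auto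
      show "AE x in L. x \<in> {y..x0} \<longrightarrow> (p + e / 2 - (x + t * u0 x))\<^sup>2 < (\<Phi> x - (x + t * u0 x))\<^sup>2"
        using v(2) AE_leb_on_neq[where c=x0 and a=a and b=b]
      proof eventually_elim
        fix x assume x: "u0 x = v x" "x \<noteq> x0"
        show "x \<in> {y..x0} \<longrightarrow> (p + e / 2 - (x + t * u0 x))\<^sup>2 < (\<Phi> x - (x + t * u0 x))\<^sup>2"
        proof
          assume xy: "x \<in> {y..x0}"
          have "p + e / 2 < x + t * u0 x" using d(2)[of x] x xy y by (auto simp: G_def dist_real_def)
          moreover have "\<Phi> x \<le> p" using p[of x] xy x y by auto
          ultimately have "\<bar>p + e / 2 - (x + t * u0 x)\<bar> < \<bar>\<Phi> x - (x + t * u0 x)\<bar>" using e by auto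
          then show "(p + e / 2 - (x + t * u0 x))\<^sup>2 < (\<Phi> x - (x + t * u0 x))\<^sup>2" by (rule less_square_if_abs_less)
        qed
      qed
    qed (use y x0 in auto)
  next
    case False
    then have *: "G x0 < p + 3 * e / 4" using e by auto
    have "\<forall>\<^sub>F x in at x0. G x < p + 3 * e / 4" using order_tendstoD(2)[OF G[unfolded isCont_def] *] .
    then obtain d where d: "d > 0" "\<And>x. x \<noteq> x0 \<Longrightarrow> dist x x0 < d \<Longrightarrow> G x < p + 3 * e / 4"
      unfolding eventually_at by blast
    define z where "z = min ((b + x0) / 2) (x0 + d / 2)"
    have z: "z < b" "x0 < z" "z < x0 + d" using x0 d by (auto simp: z_def min_less_iff_disj)
    show ?thesis
    proof (rule strict_improvement[OF \<Phi>, of x0 z "p + 3 * e / 4"])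
      show "\<Phi> x \<le> p + 3 * e / 4" if "x \<in> {a..<x0}" for x using p[of x] that e by auto
      show "p + 3 * e / 4 \<le> \<Phi> x" if "x \<in> {z<..b}" for x using q[of x] that z e by auto
      show "AE x in L. x \<in> {x0..z} \<longrightarrow> (p + 3 * e / 4 - (x + t * u0 x))\<^sup>2 < (\<Phi> x - (x + t * u0 x))\<^sup>2"
        using v(2) AE_leb_on_neq[where c=x0 and a=a and b=b]
      proof eventually_elim
        fix x assume x: "u0 x = v x" "x \<noteq> x0"
        show "x \<in> {x0..z} \<longrightarrow> (p + 3 * e / 4 - (x + t * u0 x))\<^sup>2 < (\<Phi> x - (x + t * u0 x))\<^sup>2"
        proof
          assume xz: "x \<in> {x0..z}"
          have "x + t * u0 x < p + 3 * e / 4" using d(2)[of x] x xz z by (auto simp: G_def dist_real_def)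
          moreover have "p + e \<le> \<Phi> x" using q[of x] xz x z by auto
          ultimately have "\<bar>p + 3 * e / 4 - (x + t * u0 x)\<bar> < \<bar>\<Phi> x - (x + t * u0 x)\<bar>" using e by auto
          then show "(p + 3 * e / 4 - (x + t * u0 x))\<^sup>2 < (\<Phi> x - (x + t * u0 x))\<^sup>2" by (rule less_square_if_abs_less)
        qed
      qed
    qed (use z x0 in auto)
  qed
  then show False using min by force
qed

text \<open>
  If \<open>\<Psi>\<^sub>k(x)\<close> exceeds \<open>\<Phi>(z)\<close> by \<open>e\<close> for some \<open>z > x\<close>, then by monotonicity \<open>\<Psi>\<^sub>k\<close> exceeds \<open>\<Phi>\<close>
  by \<open>e\<close> on all of \<open>[x, z]\<close>, so that their distance in \<open>L\<^sup>2(\<mu>)\<close> is bounded below. The same happens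
  on the left, and since \<open>\<Phi>\<close> has no jump at \<open>x\<close>, its values at suitable points on both sides are
  within \<open>e\<close> of each other.
\<close>

lemma minimizing_sequence_tendsto:
  assumes \<Phi>: "\<Phi> \<in> Helly a b" and min: "\<And>\<Psi>. \<Psi> \<in> Helly a b \<Longrightarrow> F0 \<Phi> \<le> F0 \<Psi>"
    and \<Psi>: "\<And>k. \<Psi> k \<in> Helly a b" and lim: "(\<lambda>k. F0 (\<Psi> k)) \<longlonglongrightarrow> F0 \<Phi>" and x: "x \<in> {a..b}"
  shows "(\<lambda>k. \<Psi> k x) \<longlonglongrightarrow> \<Phi> x"
proof -
  consider "x = a" | "x = b" | "a < x" "x < b" using x by force
  then show ?thesis
  proof cases
    case 3
    define S where "S = (\<lambda>k. \<integral>s. (\<Psi> k s - \<Phi> s)\<^sup>2 \<partial>\<mu>)"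
    have S0: "S \<longlonglongrightarrow> 0"
    proof (rule tendsto_sandwich[of "\<lambda>_. 0" _ _ "\<lambda>k. 4 * ((F0 (\<Psi> k) - F0 \<Phi>) + (F0 \<Phi> - F0 \<Phi>))"])
      show "\<forall>\<^sub>F k in sequentially. S k \<le> 4 * ((F0 (\<Psi> k) - F0 \<Phi>) + (F0 \<Phi> - F0 \<Phi>))"
        unfolding S_def by (intro always_eventually allI L2_distance_le_excess \<Psi> \<Phi> min)
      have "(\<lambda>k. 4 * ((F0 (\<Psi> k) - F0 \<Phi>) + (F0 \<Phi> - F0 \<Phi>))) \<longlonglongrightarrow> 4 * ((F0 \<Phi> - F0 \<Phi>) + (F0 \<Phi> - F0 \<Phi>))"
        by (intro tendsto_intros lim)
      then show "(\<lambda>k. 4 * ((F0 (\<Psi> k) - F0 \<Phi>) + (F0 \<Phi> - F0 \<Phi>))) \<longlonglongrightarrow> 0" by simp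
    qed (auto simp: S_def)
    have cheb: "e\<^sup>2 * measure \<mu> {c..d} \<le> S k"
      if cd: "a \<le> c" "c \<le> d" "d \<le> b" and e: "0 \<le> e" and far: "\<And>s. s \<in> {c..d} \<Longrightarrow> e \<le> \<bar>\<Psi> k s - \<Phi> s\<bar>" for c d e k
    proof -
      have m: "{c..d} \<in> sets \<mu>" using cd by (subst sets_mu, subst sets_restrict_space_iff) auto
      have "e\<^sup>2 * measure \<mu> {c..d} = (\<integral>s. e\<^sup>2 * indicator {c..d} s \<partial>\<mu>)"
        using m cd by (simp add: Int_absorb2)
      also have "\<dots> \<le> S k"
        unfolding S_def
      proof (rule integral_mono)
        show "integrable \<mu> (\<lambda>s. e\<^sup>2 * indicator {c..d} s)" 
          using m by (intro integrable_mult_right integrable_real_indicator) (simp_all add: P.emeasure_eq_measure)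
        show "integrable \<mu> (\<lambda>s. (\<Psi> k s - \<Phi> s)\<^sup>2)" by (rule integrable_diff_square[OF \<Psi> \<Phi>])
        show "e\<^sup>2 * indicator {c..d} s \<le> (\<Psi> k s - \<Phi> s)\<^sup>2" for s
          using far[of s] e by (auto simp: indicator_def intro!: abs_le_square_iff[THEN iffD1])
      qed
      finally show ?thesis .
    qed
    show ?thesis
    proof (rule LIMSEQ_I)
      fix e0 :: real assume e0: "0 < e0"
      define e where "e = e0 / 3"
      have e: "e > 0" using e0 by (simp add: e_def)
      obtain y z where yz: "a < y" "y < x" "x < z" "z < b" "\<Phi> z - \<Phi> y < e"
        using minimizer_has_no_jump[OF \<Phi> min 3 e] by blast
      define M where "M = min (measure \<mu> {y..x}) (measure \<mu> {x..z})"
      have "M > 0" using measure_mu_interval_pos[of y x] measure_mu_interval_pos[of x z] yz by (auto simp: M_def)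
      then have "e\<^sup>2 * M > 0" using e by simp
      from order_tendstoD(2)[OF S0 this] obtain N where N: "\<And>k. k \<ge> N \<Longrightarrow> S k < e\<^sup>2 * M"
        unfolding eventually_sequentially by blast
      have "norm (\<Psi> k x - \<Phi> x) < e0" if k: "k \<ge> N" for k
      proof -
        note mono\<Phi> = mono_onD[OF HellyD(1)[OF \<Phi>]] and mono\<Psi> = mono_onD[OF HellyD(1)[OF \<Psi>[of k]]]
        have up: "\<Psi> k x \<le> \<Phi> z + e"
        proof (rule ccontr)
          assume n: "\<not> \<Psi> k x \<le> \<Phi> z + e"
          have "e\<^sup>2 * measure \<mu> {x..z} \<le> S k"
          proof (rule cheb)
            fix s assume s: "s \<in> {x..z}"
            then have "\<Psi> k x \<le> \<Psi> k s" "\<Phi> s \<le> \<Phi> z" using mono\<Phi>[of s z] mono\<Psi>[of x s] yz x by auto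
            then show "e \<le> \<bar>\<Psi> k s - \<Phi> s\<bar>" using n by linarith
          qed (use yz 3 e in auto)
          moreover have "e\<^sup>2 * M \<le> e\<^sup>2 * measure \<mu> {x..z}" by (intro mult_left_mono) (auto simp: M_def)
          ultimately show False using N[OF k] by linarith
        qed
        have down: "\<Phi> y - e \<le> \<Psi> k x"
        proof (rule ccontr)
          assume n: "\<not> \<Phi> y - e \<le> \<Psi> k x"
          have "e\<^sup>2 * measure \<mu> {y..x} \<le> S k"
          proof (rule cheb)
            fix s assume s: "s \<in> {y..x}"
            then have "\<Psi> k s \<le> \<Psi> k x" "\<Phi> y \<le> \<Phi> s" using mono\<Phi>[of y s] mono\<Psi>[of s x] yz x by auto
            then show "e \<le> \<bar>\<Psi> k s - \<Phi> s\<bar>" using n by linarith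
          qed (use yz 3 e in auto)
          moreover have "e\<^sup>2 * M \<le> e\<^sup>2 * measure \<mu> {y..x}" by (intro mult_left_mono) (auto simp: M_def)
          ultimately show False using N[OF k] by linarith
        qed
        have "\<Phi> y \<le> \<Phi> x" "\<Phi> x \<le> \<Phi> z" using mono\<Phi>[of y x] mono\<Phi>[of x z] yz x by auto
        then show ?thesis using up down yz(5) e by (simp add: e_def abs_less_iff)
      qed
      then show "\<exists>no. \<forall>n\<ge>no. norm (\<Psi> n x - \<Phi> x) < e0" by blast
    qed
  qed (use HellyD(2,3)[OF \<Phi>] HellyD(2,3)[OF \<Psi>] in auto)
qed
end

section \<open>The limit of vanishing entropy\<close>

context quadratic_problem
begin

text \<open>
  Upper and lower bounds differ in kind: the lower one is uniform over the Helly space, the upper one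
  involves the entropy of the pushforward.
\<close>

lemma entropic_bounds:
  obtains C where "C \<ge> 0"
    and "\<And>\<alpha> \<Phi>. \<alpha> > 0 \<Longrightarrow> \<Phi> \<in> Helly a b \<Longrightarrow>
      ereal (F0 \<Phi> - \<alpha> * C) \<le> F_ent a b \<mu> \<alpha> (f_ent a b \<mu> \<alpha> (\<lambda>x. t * u0 x)) \<Phi>"
    and "\<And>\<alpha> \<Phi> E. \<alpha> > 0 \<Longrightarrow> \<Phi> \<in> Helly a b \<Longrightarrow> Ent a b (distr \<mu> L \<Phi>) \<le> ereal E \<Longrightarrow>
      F_ent a b \<mu> \<alpha> (f_ent a b \<mu> \<alpha> (\<lambda>x. t * u0 x)) \<Phi> \<le> ereal (F0 \<Phi> + \<alpha> * (C + E))"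
proof -
  let ?f = "\<lambda>\<alpha>. f_ent a b \<mu> \<alpha> (\<lambda>x. t * u0 x)"
  obtain C where C: "C \<ge> 0"
    "\<And>\<alpha> \<Phi>. \<alpha> \<ge> 0 \<Longrightarrow> \<Phi> \<in> Helly a b \<Longrightarrow> \<bar>?f \<alpha> \<Phi> - (\<integral>x. \<Phi> x * (t * u0 x) \<partial>\<mu>)\<bar> \<le> \<alpha> * C"
    using f_ent_first_order_bound[OF W21_cmult[OF u0], of t] by blast
  have F0: "F0 \<Phi> = (\<integral>x. (\<Phi> x - x)\<^sup>2 / 2 \<partial>\<mu>) - (\<integral>x. \<Phi> x * (t * u0 x) \<partial>\<mu>)" for \<Phi>
    unfolding F_zero_def by (simp add: mult.left_commute)
  show ?thesis
  proof (rule that[of "C + (b - a)"])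
    show "0 \<le> C + (b - a)" using C ab by simp
  next
    fix \<alpha> :: real and \<Phi> assume \<alpha>: "\<alpha> > 0" and \<Phi>: "\<Phi> \<in> Helly a b"
    let ?q = "\<integral>x. (\<Phi> x - x)\<^sup>2 / 2 \<partial>\<mu>"
    have "ereal \<alpha> * ereal (- (b - a)) \<le> ereal \<alpha> * Ent a b (distr \<mu> L \<Phi>)"
      using \<alpha> ab by (intro ereal_mult_left_mono Ent_ge) auto
    then have "ereal ?q + ereal \<alpha> * ereal (- (b - a)) - ereal (?f \<alpha> \<Phi>) \<le> F_ent a b \<mu> \<alpha> (?f \<alpha>) \<Phi>"
      unfolding F_ent_def by (intro ereal_minus_mono add_left_mono order_refl)
    then have "ereal (?q + \<alpha> * (- (b - a)) - ?f \<alpha> \<Phi>) \<le> F_ent a b \<mu> \<alpha> (?f \<alpha>) \<Phi>" by simp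
    moreover have "F0 \<Phi> - \<alpha> * (C + (b - a)) \<le> ?q + \<alpha> * (- (b - a)) - ?f \<alpha> \<Phi>"
      using C(2)[of \<alpha> \<Phi>] \<alpha> \<Phi> unfolding F0 by (simp add: algebra_simps abs_le_iff)
    ultimately show "ereal (F0 \<Phi> - \<alpha> * (C + (b - a))) \<le> F_ent a b \<mu> \<alpha> (?f \<alpha>) \<Phi>"
      by (meson ereal_less_eq(3) order_trans)
  next
    fix \<alpha> :: real and \<Phi> and E :: real assume \<alpha>: "\<alpha> > 0" and \<Phi>: "\<Phi> \<in> Helly a b" and E: "Ent a b (distr \<mu> L \<Phi>) \<le> ereal E"
    let ?q = "\<integral>x. (\<Phi> x - x)\<^sup>2 / 2 \<partial>\<mu>"
    have "ereal \<alpha> * Ent a b (distr \<mu> L \<Phi>) \<le> ereal \<alpha> * ereal E"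
      using \<alpha> E by (intro ereal_mult_left_mono) auto
    then have "F_ent a b \<mu> \<alpha> (?f \<alpha>) \<Phi> \<le> ereal ?q + ereal \<alpha> * ereal E - ereal (?f \<alpha> \<Phi>)"
      unfolding F_ent_def by (intro ereal_minus_mono add_left_mono order_refl)
    then have "F_ent a b \<mu> \<alpha> (?f \<alpha>) \<Phi> \<le> ereal (?q + \<alpha> * E - ?f \<alpha> \<Phi>)" by simp
    moreover have "?q + \<alpha> * E - ?f \<alpha> \<Phi> \<le> F0 \<Phi> + \<alpha> * (C + (b - a) + E)"
    proof -
      have "0 \<le> \<alpha> * (b - a)" using \<alpha> ab by simp
      moreover have "\<alpha> * (C + (b - a) + E) = \<alpha> * C + \<alpha> * (b - a) + \<alpha> * E" by (simp add: algebra_simps)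
      moreover have "\<bar>?f \<alpha> \<Phi> - (\<integral>x. \<Phi> x * (t * u0 x) \<partial>\<mu>)\<bar> \<le> \<alpha> * C" using C(2) \<alpha> \<Phi> by simp
      ultimately show ?thesis unfolding F0 by linarith
    qed
    ultimately show "F_ent a b \<mu> \<alpha> (?f \<alpha>) \<Phi> \<le> ereal (F0 \<Phi> + \<alpha> * (C + (b - a) + E))"
      by (meson ereal_less_eq(3) order_trans)
  qed
qed

text \<open>
  The competitor is \<open>(1 - s) \<Phi> + s x\<close>, which has slope at least \<open>s\<close>. By convexity its energy exceeds
  that of \<open>\<Phi>\<close> by at most \<open>s d\<close>, where \<open>d\<close> bounds the energy difference between \<open>\<Phi>\<close> and the identity.
\<close>

lemma finite_entropy_dense_in_energy:
  assumes \<Phi>: "\<Phi> \<in> Helly a b" and \<delta>: "\<delta> > 0"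
  obtains \<Psi> E where "\<Psi> \<in> Helly a b" "F0 \<Psi> < F0 \<Phi> + \<delta>" "Ent a b (distr \<mu> L \<Psi>) \<le> ereal E"
proof -
  \<comment> \<open>The summand \<open>1\<close> only keeps \<open>d\<close> positive.\<close>
  define d where "d = \<bar>F0 (\<lambda>x\<in>{a..b}. x) - F0 \<Phi>\<bar> + 1"
  define s where "s = min 1 (\<delta> / (2 * d))"
  have d: "d > 0" by (simp add: d_def)
  have s: "0 < s" "s \<le> 1" "s * d < \<delta>"
  proof -
    show "0 < s" "s \<le> 1" using d \<delta> by (auto simp: s_def)
    have "s * d \<le> \<delta> / (2 * d) * d" using d by (intro mult_right_mono) (auto simp: s_def)
    also have "\<dots> < \<delta>" using d \<delta> by simp
    finally show "s * d < \<delta>" .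
  qed
  let ?id = "\<lambda>x\<in>{a..b}. x :: real"
  define \<Psi> where "\<Psi> = (\<lambda>x\<in>{a..b}. (1 - s) * \<Phi> x + s * ?id x)"
  have \<Psi>: "\<Psi> \<in> Helly a b" unfolding \<Psi>_def using s by (intro Helly_convex \<Phi> Helly_id) auto
  have "Ent a b (distr \<mu> L \<Psi>) < \<infinity>"
  proof (rule Ent_pushforward_less_infinity[OF \<Psi> s(1)])
    fix x y assume xy: "a \<le> x" "x \<le> y" "y \<le> b"
    have "0 \<le> (1 - s) * (\<Phi> y - \<Phi> x)"
      using mono_onD[OF HellyD(1)[OF \<Phi>], of x y] xy s by simp
    then show "s * (y - x) \<le> \<Psi> y - \<Psi> x" using xy by (simp add: \<Psi>_def algebra_simps)
  qed
  then obtain E where E: "Ent a b (distr \<mu> L \<Psi>) \<le> ereal E"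
    by (cases "Ent a b (distr \<mu> L \<Psi>)") auto
  have "0 \<le> s * (1 - s) / 2 * (\<integral>x. (\<Phi> x - ?id x)\<^sup>2 \<partial>\<mu>)" using s by simp
  then have "F0 \<Psi> \<le> (1 - s) * F0 \<Phi> + s * F0 ?id"
    unfolding \<Psi>_def using F0_convex_combination[OF \<Phi> Helly_id, of s] s by simp
  also have "\<dots> = F0 \<Phi> + s * (F0 ?id - F0 \<Phi>)" by (simp add: algebra_simps)
  also have "\<dots> \<le> F0 \<Phi> + s * d" using s by (intro add_left_mono mult_left_mono) (auto simp: d_def)
  also have "\<dots> < F0 \<Phi> + \<delta>" using s by simp
  finally show ?thesis using that \<Psi> E by blast
qed

lemma entropic_minimizers_minimizing:
  assumes \<Phi>\<^sub>0: "\<Phi>\<^sub>0 \<in> Helly a b" and min: "\<And>\<Psi>. \<Psi> \<in> Helly a b \<Longrightarrow> F0 \<Phi>\<^sub>0 \<le> F0 \<Psi>"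
    and \<alpha>: "\<And>k. 0 < \<alpha> k" "\<alpha> \<longlonglongrightarrow> 0"
    and \<Phi>: "\<And>k. \<Phi> k \<in> Helly a b"
    and \<Phi>min: "\<And>k \<Psi>. \<Psi> \<in> Helly a b \<Longrightarrow>
      F_ent a b \<mu> (\<alpha> k) (f_ent a b \<mu> (\<alpha> k) (\<lambda>x. t * u0 x)) (\<Phi> k)
      \<le> F_ent a b \<mu> (\<alpha> k) (f_ent a b \<mu> (\<alpha> k) (\<lambda>x. t * u0 x)) \<Psi>"
  shows "(\<lambda>k. F0 (\<Phi> k)) \<longlonglongrightarrow> F0 \<Phi>\<^sub>0"
proof (rule order_tendstoI)
  fix y assume "y < F0 \<Phi>\<^sub>0"
  then show "\<forall>\<^sub>F k in sequentially. y < F0 (\<Phi> k)"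
    using less_le_trans[OF _ min[OF \<Phi>]] by simp
next
  fix y assume "F0 \<Phi>\<^sub>0 < y"
  then have "0 < y - F0 \<Phi>\<^sub>0" by simp
  from finite_entropy_dense_in_energy[OF \<Phi>\<^sub>0 this]
  obtain \<Psi> E where \<Psi>: "\<Psi> \<in> Helly a b" "F0 \<Psi> < y" "Ent a b (distr \<mu> L \<Psi>) \<le> ereal E"
    by auto
  obtain C where C: "\<And>\<alpha> \<Phi>. \<alpha> > 0 \<Longrightarrow> \<Phi> \<in> Helly a b \<Longrightarrow>
      ereal (F0 \<Phi> - \<alpha> * C) \<le> F_ent a b \<mu> \<alpha> (f_ent a b \<mu> \<alpha> (\<lambda>x. t * u0 x)) \<Phi>"
    "\<And>\<alpha> \<Phi> E. \<alpha> > 0 \<Longrightarrow> \<Phi> \<in> Helly a b \<Longrightarrow> Ent a b (distr \<mu> L \<Phi>) \<le> ereal E \<Longrightarrow>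
      F_ent a b \<mu> \<alpha> (f_ent a b \<mu> \<alpha> (\<lambda>x. t * u0 x)) \<Phi> \<le> ereal (F0 \<Phi> + \<alpha> * (C + E))"
    using entropic_bounds by metis
  have le: "F0 (\<Phi> k) \<le> F0 \<Psi> + \<alpha> k * (2 * C + E)" for k
  proof -
    have "ereal (F0 (\<Phi> k) - \<alpha> k * C) \<le> ereal (F0 \<Psi> + \<alpha> k * (C + E))"
      using C(1)[OF \<alpha>(1) \<Phi>] \<Phi>min[OF \<Psi>(1)] C(2)[OF \<alpha>(1) \<Psi>(1,3)] by (meson order_trans)
    then show ?thesis by (simp add: algebra_simps)
  qed
  have "(\<lambda>k. F0 \<Psi> + \<alpha> k * (2 * C + E)) \<longlonglongrightarrow> F0 \<Psi> + 0 * (2 * C + E)"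
    by (intro tendsto_intros \<alpha>)
  then have "\<forall>\<^sub>F k in sequentially. F0 \<Psi> + \<alpha> k * (2 * C + E) < y"
    by (rule order_tendstoD(2)) (use \<Psi> in simp)
  then show "\<forall>\<^sub>F k in sequentially. F0 (\<Phi> k) < y"
    by eventually_elim (use le in \<open>blast intro: le_less_trans\<close>)
qed
end

theorem corollary3p5:
  fixes a b t :: real and \<mu> :: "real measure" and u0 :: "real \<Rightarrow> real"
    and \<alpha> :: "nat \<Rightarrow> real" and \<Phi> :: "nat \<Rightarrow> real \<Rightarrow> real"
  assumes "a < b"
    and "sets \<mu> = sets (restrict_space borel {a..b})"
    and "prob_space \<mu>"
    and "absolutely_continuous (leb_on a b) \<mu>"
    and "dens a b \<mu> \<in> W11 a b"
    and "0 < essinf (leb_on a b) (RN_deriv (leb_on a b) \<mu>)"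
    and "esssup (leb_on a b) (RN_deriv (leb_on a b) \<mu>) < \<infinity>"
    and "u0 \<in> W21 a b"
    and "0 \<le> t"
    and "\<And>k. 0 < \<alpha> k"
    and "\<alpha> \<longlonglongrightarrow> 0"
    and "\<And>k. is_arg_min (F_ent a b \<mu> (\<alpha> k) (f_ent a b \<mu> (\<alpha> k) (\<lambda>x. t * u0 x)))
                (\<lambda>\<Psi>. \<Psi> \<in> Helly a b) (\<Phi> k)"
  shows "\<exists>\<Phi>\<^sub>0. is_arg_min (F_zero \<mu> t u0) (\<lambda>\<Psi>. \<Psi> \<in> Helly a b) \<Phi>\<^sub>0
           \<and> (\<forall>\<Psi>. is_arg_min (F_zero \<mu> t u0) (\<lambda>\<Psi>. \<Psi> \<in> Helly a b) \<Psi> \<longrightarrow> \<Psi> = \<Phi>\<^sub>0)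
           \<and> (\<forall>x\<in>{a..b}. (\<lambda>k. \<Phi> k x) \<longlonglongrightarrow> \<Phi>\<^sub>0 x)"
proof -
  interpret quadratic_problem a b \<mu> t u0
    by (intro quadratic_problem.intro bounded_density.intro quadratic_problem_axioms.intro) (fact assms(1-9))+
  obtain \<Phi>\<^sub>0 where \<Phi>\<^sub>0: "\<Phi>\<^sub>0 \<in> Helly a b" and min: "\<And>\<Psi>. \<Psi> \<in> Helly a b \<Longrightarrow> F0 \<Phi>\<^sub>0 \<le> F0 \<Psi>"
    using minimizer_exists by blast
  have \<Phi>: "\<Phi> k \<in> Helly a b" for k using assms(12)[of k] by (simp add: is_arg_min_def)
  have \<Phi>min: "F_ent a b \<mu> (\<alpha> k) (f_ent a b \<mu> (\<alpha> k) (\<lambda>x. t * u0 x)) (\<Phi> k)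
      \<le> F_ent a b \<mu> (\<alpha> k) (f_ent a b \<mu> (\<alpha> k) (\<lambda>x. t * u0 x)) \<Psi>" if "\<Psi> \<in> Helly a b" for k \<Psi>
    using assms(12)[of k] that by (auto simp: is_arg_min_def not_less)
  have "is_arg_min F0 (\<lambda>\<Psi>. \<Psi> \<in> Helly a b) \<Phi>\<^sub>0"
    using \<Phi>\<^sub>0 min by (auto simp: is_arg_min_def not_less)
  moreover have "\<Psi> = \<Phi>\<^sub>0" if \<Psi>: "is_arg_min F0 (\<lambda>\<Psi>. \<Psi> \<in> Helly a b) \<Psi>" for \<Psi>
  proof
    have \<Psi>H: "\<Psi> \<in> Helly a b" and "F0 \<Psi> \<le> F0 \<Phi>\<^sub>0" using \<Psi> \<Phi>\<^sub>0 by (auto simp: is_arg_min_def not_less)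
    with min[OF \<Psi>H] have eq: "F0 \<Psi> = F0 \<Phi>\<^sub>0" by simp
    fix x
    show "\<Psi> x = \<Phi>\<^sub>0 x"
    proof (cases "x \<in> {a..b}")
      case True
      have "(\<lambda>k::nat. \<Psi> x) \<longlonglongrightarrow> \<Phi>\<^sub>0 x"
        by (rule minimizing_sequence_tendsto[OF \<Phi>\<^sub>0 min, of "\<lambda>_. \<Psi>"]) (use \<Psi>H eq True in auto)
      then show ?thesis by (simp add: LIMSEQ_const_iff)
    next
      case False
      then show ?thesis using \<Psi>H \<Phi>\<^sub>0 by (auto simp: Helly_def PiE_def extensional_def)
    qed
  qed
  moreover have "(\<lambda>k. \<Phi> k x) \<longlonglongrightarrow> \<Phi>\<^sub>0 x" if "x \<in> {a..b}" for x
    by (rule minimizing_sequence_tendsto[OF \<Phi>\<^sub>0 min \<Phi>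
          entropic_minimizers_minimizing[OF \<Phi>\<^sub>0 min assms(10,11) \<Phi> \<Phi>min] that])
  ultimately show ?thesis by blast
qed

end
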